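(* Let $G$ be a countably infinite amenable group and let $\mathcal{F} = (F_n)_{n = 1}^\infty$ be a left-Følner sequence in $G$. Given a measure preserving system $(X,\mathscr{B},\mu,(\tau_g)_{g \in G})$ and $f \in L^\infty(X,\mu)$, there exists a bounded sequence of complex numbers $(c_g)_{g \in G} \subseteq \text{range}(f)$ satisfying $$\lim_{n\rightarrow\infty}\frac{1}{|F_n|}\sum_{g \in F_n}c_g = \int_Xf\,d\mu,\qquad \lim_{n\rightarrow\infty}\frac{1}{|F_n|}\sum_{g \in F_n}c_{hg}\overline{c_g} = \langle \tau_hf,f\rangle\ \text{ for all }h \in G,$$ and $$\lim_{n\rightarrow\infty}\frac{1}{|F_n|}\sum_{g \in F_n}d_{h_1g,1}^{t_1}d_{h_2g,2}^{t_2}\cdots d_{h_\ell g,\ell}^{t_\ell} = \int_X\tau_{h_1}f_1^{t_1}\,\tau_{h_2}f_2^{t_2}\cdots \tau_{h_\ell}f_\ell^{t_\ell}\, d\mu$$ for all $\ell\in\mathbb{N}$, all $t_1,\dots,t_\ell \in \mathbb{N}$, all $h_1,\dots,h_\ell \in G$, and all choices (for $1\le i\le \ell$) of $(d_{g,i})_{g \in G} \in \left\{(c_g)_{g \in G},(\overline{c_g})_{g \in G}\right\}$ and $f_i \in \{f,\overline{f}\}$ such that $(d_{g,i})_{g \in G} = (c_g)_{g \in G}$ is chosen if and only if $f_i = f$ is chosen.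
   Context: A left-Følner sequence in a countable group $G$ is a sequence of finite nonempty sets $F_n\subseteq G$ with $\lim_{n\to\infty}|F_n\triangle gF_n|/|F_n|=0$ for all $g\in G$; $G$ is amenable if it has one. A measure preserving system $(X,\mathscr{B},\mu,(\tau_g)_{g\in G})$ is a probability space $(X,\mathscr{B},\mu)$ with a measurable action $\tau$ of $G$ on $X$ satisfying $\mu(\tau_gA)=\mu(A)$ for all $g\in G$, $A\in\mathscr{B}$. For a function $f$ on $X$, $\tau_gf:=f\circ\tau_g$, and $\langle f_1,f_2\rangle=\int_Xf_1\overline{f_2}\,d\mu$. $\mathbb{N}=\{1,2,\dots\}$. *)

theory Defs
  imports "HOL-Probability.Probability" "HOL-Algebra.Group_Action"
begin

definition left_Folner :: "('g, 'b) monoid_scheme \<Rightarrow> (nat \<Rightarrow> 'g set) \<Rightarrow> bool" where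
  "left_Folner G F \<longleftrightarrow>
     (\<forall>n. finite (F n) \<and> F n \<noteq> {} \<and> F n \<subseteq> carrier G) \<and>
     (\<forall>g\<in>carrier G.
        (\<lambda>n. real (card (sym_diff (F n) (g <#\<^bsub>G\<^esub> F n))) / real (card (F n))) \<longlonglongrightarrow> 0)"

definition amenable :: "('g, 'b) monoid_scheme \<Rightarrow> bool" where
  "amenable G \<longleftrightarrow> (\<exists>F. left_Folner G F)"

text \<open>
  \<^const>\<open>group_action\<close> makes every \<open>\<tau> g\<close> a bijection of \<^term>\<open>space M\<close>, taken to be
  \<open>undefined\<close> outside \<^term>\<open>space M\<close>.  The group is discrete, so measurability of the action is
  measurability of each \<open>\<tau> g\<close>; applied to the inverse of \<open>g\<close>, it also makes the image
  \<open>\<tau> g ` A\<close> of a measurable set measurable.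
\<close>

definition measure_preserving_system ::
  "('g, 'b) monoid_scheme \<Rightarrow> 'x measure \<Rightarrow> ('g \<Rightarrow> 'x \<Rightarrow> 'x) \<Rightarrow> bool" where
  "measure_preserving_system G M \<tau> \<longleftrightarrow>
     prob_space M \<and> group_action G (space M) \<tau> \<and>
     (\<forall>g\<in>carrier G. \<tau> g \<in> M \<rightarrow>\<^sub>M M) \<and>
     (\<forall>g\<in>carrier G. \<forall>A\<in>sets M. measure M (\<tau> g ` A) = measure M A)"

text \<open>
  Elements of \<open>L_infty M\<close> are genuine functions (representatives), so that their range is
  meaningful; they are only essentially bounded.
\<close>

definition L_infty :: "'x measure \<Rightarrow> ('x \<Rightarrow> complex) set" where
  "L_infty M = {f \<in> borel_measurable M. \<exists>C::real. AE x in M. norm (f x) \<le> C}"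

definition translate :: "('g \<Rightarrow> 'x \<Rightarrow> 'x) \<Rightarrow> 'g \<Rightarrow> ('x \<Rightarrow> complex) \<Rightarrow> 'x \<Rightarrow> complex" where
  "translate \<tau> g f = f \<circ> \<tau> g"

definition L2_inner :: "'x measure \<Rightarrow> ('x \<Rightarrow> complex) \<Rightarrow> ('x \<Rightarrow> complex) \<Rightarrow> complex" where
  "L2_inner M f1 f2 = (\<integral>x. f1 x * cnj (f2 x) \<partial>M)"

end

theory Submission
  imports Defs
begin

text \<open>
  Why a sequence like \<open>c\<close> exists.  A monomial in finitely many translates of \<open>c\<close>, evaluated at
  \<open>g\<close>, is a function of the shifted coloring \<open>h \<mapsto> c (h g)\<close>.  After subtracting the
  integral of the corresponding product of translates of \<open>f\<close>, the theorem says that countably many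
  such test functions \<open>\<psi>\<close> have averages along \<open>F\<close> tending to \<open>0\<close>.

  Orbits supply the raw material.  If \<open>c (s a) = f (\<tau> s x)\<close> for \<open>s\<close> in a nearly invariant finite
  set \<open>S\<close>, then, up to boundary terms, the sum of \<open>\<psi>\<close> over \<open>S a\<close> is a function of \<open>x\<close> whose integral
  vanishes, because \<open>\<tau>\<close> preserves the measure.  For one \<open>x\<close> this function need not be small, as the
  system need not be ergodic; but on many disjoint translates \<open>S a j\<close> one can choose points \<open>x j\<close>
  for which the contributions cancel (\<open>finite_sample\<close>).  The result is a stock of words: colored
  finite sets, as invariant as desired, over which every test function has average almost \<open>0\<close>
  (\<open>word_supply_of_action\<close>).

  The sets \<open>F n\<close> may grow slowly and lie anywhere in the group, so a coloring has to be good on all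
  sufficiently invariant finite sets at once; this is a local requirement, and it is met by covering
  the group with words.  The covering is a quasi-tiling in the sense of Ornstein and Weiss
  (\<open>tiling_exists\<close>): placing translates of one shape greedily captures a fixed proportion of what is
  left uncovered, and the pieces placed earlier stay out of the way because they come from shapes
  much more invariant than the current one.  Words on the tiles then give, for each tolerance, a
  coloring whose averages are within that tolerance of \<open>0\<close> on every sufficiently invariant set
  (\<open>uniform_coloring\<close>).

  To let the tolerance tend to \<open>0\<close>, the coloring of tolerance \<open>1 / (k + 1)\<close> is used on a region
  between two finite sets \<open>A k\<close> and \<open>A (k + 1)\<close>.  Some \<open>F n\<close> may run along the edge of such a set, so
  the edge must be sparse in every sufficiently invariant set.  A union of pieces of a quasi-tiling
  has this property, and the degree of invariance needed does not depend on which pieces are taken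
  (\<open>glue_colorings\<close>).  Hence \<open>A (k + 1)\<close> may be chosen after it is known which \<open>F n\<close> are
  not yet invariant enough, and can be made to swallow those (\<open>generic_coloring\<close>).
\<close>

section \<open>Boundaries, densities and families of shapes\<close>

locale countable_group = group G for G (structure) +
  assumes countable_carrier: "countable (carrier G)"
begin

text \<open>
  The inner boundary of \<open>E\<close> for left translation by \<open>L\<close>.  A set is nearly invariant when this is
  a small part of it.
\<close>

definition bd :: "'a set \<Rightarrow> 'a set \<Rightarrow> 'a set" where
  "bd L E = {g \<in> E. \<exists>h\<in>L. h \<otimes> g \<notin> E}"

lemma bd_subset: "bd L E \<subseteq> E"
  by (auto simp: bd_def)

lemma finite_bd: "finite E \<Longrightarrow> finite (bd L E)"
  by (meson bd_subset finite_subset)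

lemma card_bd_mono: "finite E \<Longrightarrow> L \<subseteq> L' \<Longrightarrow> card (bd L E) \<le> card (bd L' E)"
  by (rule card_mono) (auto simp: bd_def)

lemma card_bd_mult_mono:
  assumes "finite E" "L \<subseteq> L'" "0 \<le> C" "C \<le> C'"
  shows "C * real (card (bd L E)) \<le> C' * real (card (bd L' E))"
  using assms card_bd_mono by (intro mult_mono) auto

lemma card_left_translate:
  assumes "h \<in> carrier G" "A \<subseteq> carrier G" "finite B" "\<And>g. g \<in> A \<Longrightarrow> h \<otimes> g \<in> B"
  shows "card A \<le> card B"
proof (rule card_inj_on_le)
  show "inj_on ((\<otimes>) h) A"
    using assms(1,2) by (intro inj_onI) (metis Units_eq Units_l_cancel subsetD)
qed (use assms in auto)

lemma r_coset_image: "T #> a = (\<lambda>x. x \<otimes> a) ` T"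
  by (auto simp: r_coset_def)

lemma inj_on_mult_right: "T \<subseteq> carrier G \<Longrightarrow> a \<in> carrier G \<Longrightarrow> inj_on (\<lambda>x. x \<otimes> a) T"
  by (intro inj_onI) (metis right_cancel subsetD)

lemma card_r_coset:
  "T \<subseteq> carrier G \<Longrightarrow> a \<in> carrier G \<Longrightarrow> card (T #> a) = card T"
  unfolding r_coset_image by (intro card_image inj_on_mult_right)

lemma bd_r_coset:
  assumes "T \<subseteq> carrier G" "a \<in> carrier G" "L \<subseteq> carrier G"
  shows "bd L (T #> a) = bd L T #> a"
proof -
  have "h \<otimes> (x \<otimes> a) \<in> (\<lambda>x. x \<otimes> a) ` T \<longleftrightarrow> h \<otimes> x \<in> T" if "h \<in> L" "x \<in> T" for h x
  proof -
    have hx: "h \<in> carrier G" "x \<in> carrier G" using that assms by auto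
    have "h \<otimes> x = y" if "h \<otimes> (x \<otimes> a) = y \<otimes> a" "y \<in> T" for y
    proof -
      have "y \<in> carrier G" using that assms by auto
      then show ?thesis using that(1) hx assms by (simp flip: m_assoc)
    qed
    moreover have "h \<otimes> (x \<otimes> a) = (h \<otimes> x) \<otimes> a" using hx assms by (simp add: m_assoc)
    ultimately show ?thesis by (metis (no_types, lifting) imageE image_eqI)
  qed
  then have *: "(\<exists>h\<in>L. h \<otimes> (x \<otimes> a) \<notin> (\<lambda>x. x \<otimes> a) ` T) \<longleftrightarrow> (\<exists>h\<in>L. h \<otimes> x \<notin> T)" if "x \<in> T" for x
    using that by blast
  show ?thesis unfolding r_coset_image bd_def Compr_image_eq
    by (intro arg_cong[of _ _ "image _"] Collect_cong conj_cong refl *)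
qed

text \<open>
  The upper density of \<open>Z\<close> is at most \<open>d\<close>, uniformly over all sufficiently invariant sets.  The
  error is linear in the boundary, instead of a condition "if the boundary is small enough", so that
  the estimates for pieces of \<open>E\<close> can be added even when a piece is too small to be invariant.
\<close>

definition density_le :: "'a set \<Rightarrow> real \<Rightarrow> bool" where
  "density_le Z d \<longleftrightarrow> (\<exists>L C. finite L \<and> L \<subseteq> carrier G \<and> 0 \<le> C \<and>
     (\<forall>E. finite E \<longrightarrow> E \<subseteq> carrier G \<longrightarrow>
        real (card (E \<inter> Z)) \<le> d * real (card E) + C * real (card (bd L E))))"

text \<open>
  Shapes that may serve as tiles: arbitrarily invariant ones exist, and their translates are
  again admissible.
\<close>

definition shape_family :: "'a set set \<Rightarrow> bool" where
  "shape_family \<S> \<longleftrightarrow>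
     (\<forall>T\<in>\<S>. finite T \<and> T \<noteq> {} \<and> T \<subseteq> carrier G) \<and>
     (\<forall>T\<in>\<S>. \<forall>a\<in>carrier G. T #> a \<in> \<S>) \<and>
     (\<forall>L d. finite L \<longrightarrow> L \<subseteq> carrier G \<longrightarrow> 0 < d \<longrightarrow>
        (\<exists>T\<in>\<S>. real (card (bd L T)) \<le> d * real (card T)))"

lemma shape_familyD:
  assumes "shape_family \<S>" "T \<in> \<S>"
  shows "finite T" "T \<noteq> {}" "T \<subseteq> carrier G" "a \<in> carrier G \<Longrightarrow> T #> a \<in> \<S>"
  using assms unfolding shape_family_def by blast+

lemma shape_familyE:
  assumes "shape_family \<S>" "finite L" "L \<subseteq> carrier G" "0 < d"
  obtains T where "T \<in> \<S>" "real (card (bd L T)) \<le> d * real (card T)"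
  using assms unfolding shape_family_def by blast

text \<open>
  Demanding some invariance of all tiles costs nothing, since invariance is itself translation
  invariant and two demands can be met together.
\<close>

lemma shape_family_invariant:
  assumes \<S>: "shape_family \<S>" and L: "finite L" "L \<subseteq> carrier G" and d: "0 < d"
  shows "shape_family {T \<in> \<S>. real (card (bd L T)) \<le> d * real (card T)}"
proof -
  note D = shape_familyD(1-3)[OF \<S>]
  have 1: "real (card (bd L (T #> a))) \<le> d * real (card (T #> a))"
    if "T \<in> \<S>" "a \<in> carrier G" "real (card (bd L T)) \<le> d * real (card T)" for T a
  proof -
    have "T \<subseteq> carrier G" using D that by blast
    moreover from this have "bd L T \<subseteq> carrier G" using bd_subset order_trans by blast
    ultimately show ?thesis using that L by (simp add: bd_r_coset card_r_coset)
  qed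
  have 2: "\<exists>T\<in>\<S>. real (card (bd L T)) \<le> d * real (card T) \<and> real (card (bd L' T)) \<le> d' * real (card T)"
    if A: "finite L'" "L' \<subseteq> carrier G" "0 < d'" for L' d'
  proof -
    have "finite (L \<union> L')" "L \<union> L' \<subseteq> carrier G" "0 < min d d'" using A L d by auto
    then obtain T where T: "T \<in> \<S>" "real (card (bd (L \<union> L') T)) \<le> min d d' * real (card T)"
      by (rule shape_familyE[OF \<S>])
    have fT: "finite T" using T D by blast
    have "real (card (bd L T)) \<le> real (card (bd (L \<union> L') T))"
         "real (card (bd L' T)) \<le> real (card (bd (L \<union> L') T))"
      using card_bd_mono[OF fT] by auto
    moreover have "min d d' * real (card T) \<le> d * real (card T)" 
       "min d d' * real (card T) \<le> d' * real (card T)"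
      by (intro mult_right_mono; simp)+
    ultimately show ?thesis
      using T(2) by (intro bexI[OF _ T(1)] conjI) linarith+
  qed
  show ?thesis
    unfolding shape_family_def
  proof (intro conjI ballI allI impI)
    fix T a assume "T \<in> {T \<in> \<S>. real (card (bd L T)) \<le> d * real (card T)}" "a \<in> carrier G"
    then show "T #> a \<in> {T \<in> \<S>. real (card (bd L T)) \<le> d * real (card T)}"
      using 1 shape_familyD(4)[OF \<S>] by simp
  next
    fix L' d' assume "finite L'" "L' \<subseteq> carrier G" "0 < (d'::real)"
    from 2[OF this] show "\<exists>T\<in>{T \<in> \<S>. real (card (bd L T)) \<le> d * real (card T)}.
        real (card (bd L' T)) \<le> d' * real (card T)"
      by blast
  qed (use D in blast)+
qed

text \<open>
  A quasi-tiling.  In a pair \<open>(T, P)\<close> the tile \<open>T\<close> is an entire translate of a shape and the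
  piece \<open>P\<close> is the part of it not covered earlier; pieces are disjoint while tiles may overlap a
  little.  The overlap lies in other pieces, whence the last clause of the first line.  The set \<open>D\<close>
  bounds the size of all tiles.
\<close>

definition tiling :: "'a set set \<Rightarrow> real \<Rightarrow> ('a set \<times> 'a set) set \<Rightarrow> bool" where
  "tiling \<S> e \<T> \<longleftrightarrow>
     (\<forall>(T,P)\<in>\<T>. T \<in> \<S> \<and> P \<subseteq> T \<and> real (card (T - P)) \<le> e * real (card T) \<and> T \<subseteq> \<Union>(snd ` \<T>)) \<and>
     (\<forall>(T,P)\<in>\<T>. \<forall>(T',P')\<in>\<T>. (T,P) \<noteq> (T',P') \<longrightarrow> P \<inter> P' = {}) \<and>
     (\<exists>D. finite D \<and> D \<subseteq> carrier G \<and> (\<forall>(T,P)\<in>\<T>. \<forall>x\<in>T. \<forall>y\<in>T. x \<otimes> inv y \<in> D))"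

lemma tilingD:
  assumes "tiling \<S> e \<T>" "(T,P) \<in> \<T>"
  shows "T \<in> \<S>" "P \<subseteq> T" "real (card (T - P)) \<le> e * real (card T)" "T \<subseteq> \<Union>(snd ` \<T>)"
  using bspec[OF conjunct1[OF assms(1)[unfolded tiling_def]] assms(2)] by simp_all

lemma tiling_disjoint:
  assumes "tiling \<S> e \<T>" "(T,P) \<in> \<T>" "(T',P') \<in> \<T>" "g \<in> P" "g \<in> P'"
  shows "T = T'" "P = P'"
proof -
  have "(T,P) \<noteq> (T',P') \<longrightarrow> P \<inter> P' = {}"
    using conjunct1[OF conjunct2[OF assms(1)[unfolded tiling_def]]] assms(2,3) by fastforce
  then show "T = T'" "P = P'" using assms(4,5) by auto
qed

lemma tiling_mono: "tiling \<S> e \<T> \<Longrightarrow> \<S> \<subseteq> \<S>' \<Longrightarrow> tiling \<S>' e \<T>"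
  unfolding tiling_def by auto

lemma tile_card_le:
  assumes "shape_family \<S>" "tiling \<S> e \<T>" "(T,P) \<in> \<T>" "e \<le> 1/2"
  shows "real (card T) \<le> 2 * real (card P)"
proof -
  note D = tilingD[OF assms(2,3)]
  have fT: "finite T" using D shape_familyD assms by blast
  have "card T = card P + card (T - P)" using D fT
    by (metis card_Diff_subset card_mono finite_subset le_add_diff_inverse)
  moreover have "e * real (card T) \<le> 1/2 * real (card T)" using assms by (intro mult_right_mono) auto
  ultimately show ?thesis using D by simp
qed

text \<open>
  A function with small sums over all pieces has small sums over the tiled part of any \<open>E\<close>:
  because tiles have bounded size, a piece that meets \<open>E\<close> without being contained in it meets it only
  in the boundary.  The set \<open>L\<close> depends on the tiling alone, so it serves all functions \<open>u\<close> at once.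
\<close>

lemma tiling_sum:
  assumes \<S>: "shape_family \<S>" and \<T>: "tiling \<S> e \<T>"
  obtains L where "finite L" "L \<subseteq> carrier G"
    "\<And>(u :: 'a \<Rightarrow> 'v::real_normed_vector) B k E.
       (\<And>g. g \<in> carrier G \<Longrightarrow> norm (u g) \<le> B) \<Longrightarrow> 0 \<le> k \<Longrightarrow>
       (\<And>T P. (T,P) \<in> \<T> \<Longrightarrow> norm (sum u P) \<le> k * real (card P)) \<Longrightarrow>
       finite E \<Longrightarrow> E \<subseteq> carrier G \<Longrightarrow>
       norm (sum u (E \<inter> \<Union>(snd ` \<T>))) \<le> k * real (card E) + B * real (card (bd L E))"
proof -
  obtain D where D: "finite D" "D \<subseteq> carrier G"
    "\<And>T P x y. (T,P) \<in> \<T> \<Longrightarrow> x \<in> T \<Longrightarrow> y \<in> T \<Longrightarrow> x \<otimes> inv y \<in> D"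
    using conjunct2[OF conjunct2[OF \<T>[unfolded tiling_def]]] by fast
  show thesis
  proof (rule that[OF D(1,2)])
    fix u :: "'a \<Rightarrow> 'v" and B k E
    assume B: "\<And>g. g \<in> carrier G \<Longrightarrow> norm (u g) \<le> B"
      and k: "0 \<le> k" and P: "\<And>T P. (T,P) \<in> \<T> \<Longrightarrow> norm (sum u P) \<le> k * real (card P)"
      and E: "finite E" "E \<subseteq> carrier G"
    have B0: "0 \<le> B" using B[OF one_closed] norm_ge_zero order_trans by blast
    define PP where "PP = {P \<in> snd ` \<T>. P \<subseteq> E}"
    have finPP: "finite PP" by (rule finite_subset[of _ "Pow E"]) (use E in \<open>auto simp: PP_def\<close>)
    have dis: "A \<inter> A' = {}" if "A \<in> PP" "A' \<in> PP" "A \<noteq> A'" for A A'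
      using that tiling_disjoint[OF \<T>] unfolding PP_def by fastforce
    have finA: "finite A" if "A \<in> PP" for A using that E finite_subset by (auto simp: PP_def)
    have sub: "\<Union>PP \<subseteq> E \<inter> \<Union>(snd ` \<T>)" by (auto simp: PP_def)
    have "norm (sum u (\<Union>PP)) = norm (\<Sum>A\<in>PP. sum u A)"
      using dis finA by (subst sum.Union_disjoint) auto
    also have "\<dots> \<le> (\<Sum>A\<in>PP. k * real (card A))"
      by (rule sum_norm_le) (use P in \<open>auto simp: PP_def\<close>)
    also have "\<dots> = k * real (card (\<Union>PP))"
      using dis finA by (subst card_Union_disjoint) (auto simp: sum_distrib_left pairwise_def disjnt_def)
    also have "\<dots> \<le> k * real (card E)"
      using k sub E by (intro mult_left_mono) (auto intro!: card_mono)
    finally have 1: "norm (sum u (\<Union>PP)) \<le> k * real (card E)" .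
    have rest: "E \<inter> \<Union>(snd ` \<T>) - \<Union>PP \<subseteq> bd D E"
    proof
      fix g assume g: "g \<in> E \<inter> \<Union>(snd ` \<T>) - \<Union>PP"
      then obtain T P where TP: "(T,P) \<in> \<T>" "g \<in> P" by auto
      have "\<not> P \<subseteq> E"
      proof
        assume "P \<subseteq> E"
        then have "P \<in> PP" unfolding PP_def using TP(1) by (auto intro: image_eqI[of _ _ "(T,P)"])
        then show False using g TP(2) by blast
      qed
      then obtain y where y: "y \<in> P" "y \<notin> E" by blast
      have T: "P \<subseteq> T" "T \<subseteq> carrier G" using tilingD[OF \<T> TP(1)] shape_familyD[OF \<S>] by auto
      have yg: "y \<in> carrier G" "g \<in> carrier G" using T y TP by auto
      then have "(y \<otimes> inv g) \<otimes> g = y" by (simp add: m_assoc)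
      moreover have "y \<otimes> inv g \<in> D" using D(3)[OF TP(1)] T y TP by blast
      ultimately have "\<exists>h\<in>D. h \<otimes> g \<notin> E" using y(2) by (intro bexI[of _ "y \<otimes> inv g"]) auto
      then show "g \<in> bd D E" using g by (simp add: bd_def)
    qed
    have "norm (sum u (E \<inter> \<Union>(snd ` \<T>) - \<Union>PP)) \<le> real (card (E \<inter> \<Union>(snd ` \<T>) - \<Union>PP)) * B"
      by (rule sum_norm_bound) (use B E in auto)
    also have "\<dots> \<le> real (card (bd D E)) * B"
      using B0 rest E finite_bd by (intro mult_right_mono) (auto intro!: card_mono)
    finally have 2: "norm (sum u (E \<inter> \<Union>(snd ` \<T>) - \<Union>PP)) \<le> B * real (card (bd D E))"
      by (simp add: mult.commute)
    have "sum u (E \<inter> \<Union>(snd ` \<T>)) = sum u (E \<inter> \<Union>(snd ` \<T>) - \<Union>PP) + sum u (\<Union>PP)"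
      using sub E by (intro sum.subset_diff) auto
    then show "norm (sum u (E \<inter> \<Union>(snd ` \<T>))) \<le> k * real (card E) + B * real (card (bd D E))"
      using 1 2 norm_triangle_ineq[of "sum u (E \<inter> \<Union>(snd ` \<T>) - \<Union>PP)" "sum u (\<Union>PP)"] by simp
  qed
qed

lemma tiling_card:
  assumes \<S>: "shape_family \<S>" and \<T>: "tiling \<S> e \<T>" and k: "0 \<le> k"
    and P: "\<And>P. P \<in> snd ` \<T> \<Longrightarrow> real (card (P \<inter> Z)) \<le> k * real (card P)"
  obtains L where "finite L" "L \<subseteq> carrier G"
    "\<And>E. finite E \<Longrightarrow> E \<subseteq> carrier G \<Longrightarrow>
       real (card (E \<inter> \<Union>(snd ` \<T>) \<inter> Z)) \<le> k * real (card E) + real (card (bd L E))"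
proof -
  have *: "norm (sum (indicat_real Z) A) = real (card (A \<inter> Z))" if "finite A" for A
    using that by (simp add: indicator_def sum.If_cases)
  have fin: "finite P" if "(T,P) \<in> \<T>" for T P
    using tilingD[OF \<T> that] shape_familyD[OF \<S>] finite_subset by blast
  obtain L where L: "finite L" "L \<subseteq> carrier G"
    "\<And>(u :: 'a \<Rightarrow> real) B k E.
       (\<And>g. g \<in> carrier G \<Longrightarrow> norm (u g) \<le> B) \<Longrightarrow> 0 \<le> k \<Longrightarrow>
       (\<And>T P. (T,P) \<in> \<T> \<Longrightarrow> norm (sum u P) \<le> k * real (card P)) \<Longrightarrow>
       finite E \<Longrightarrow> E \<subseteq> carrier G \<Longrightarrow>
       norm (sum u (E \<inter> \<Union>(snd ` \<T>))) \<le> k * real (card E) + B * real (card (bd L E))"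
    using tiling_sum[OF \<S> \<T>] by metis
  show thesis
  proof (rule that[OF L(1,2)])
    fix E assume E: "finite E" "E \<subseteq> carrier G"
    have "norm (sum (indicat_real Z) P) \<le> k * real (card P)" if "(T,P) \<in> \<T>" for T P
      using P[of P] that *[OF fin[OF that]] by force
    then have "norm (sum (indicat_real Z) (E \<inter> \<Union>(snd ` \<T>))) \<le> k * real (card E) + 1 * real (card (bd L E))"
      using k E by (intro L(3)) (auto simp: indicator_def)
    then show "real (card (E \<inter> \<Union>(snd ` \<T>) \<inter> Z)) \<le> k * real (card E) + real (card (bd L E))"
      using E * by simp
  qed
qed

section \<open>Existence of quasi-tilings\<close>

lemma density_le_mono:
  assumes "density_le Z d" "d \<le> d'"
  shows "density_le Z d'"
proof -
  obtain L C where LC: "finite L" "L \<subseteq> carrier G" "0 \<le> C"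
    "\<And>E. finite E \<Longrightarrow> E \<subseteq> carrier G \<Longrightarrow> real (card (E \<inter> Z)) \<le> d * real (card E) + C * real (card (bd L E))"
    using assms(1) unfolding density_le_def by blast
  have "real (card (E \<inter> Z)) \<le> d' * real (card E) + C * real (card (bd L E))"
    if "finite E" "E \<subseteq> carrier G" for E
    using LC(4)[OF that] mult_right_mono[OF assms(2), of "real (card E)"] by simp
  then show ?thesis unfolding density_le_def using LC(1-3) by blast
qed

text \<open>
  Run through the group and add the translate \<open>S #> c\<close> whenever at most the proportion \<open>e\<close> of it
  is already covered.  A translate that is skipped is covered to the proportion \<open>e\<close> by what made it
  be skipped, and one that is added is covered entirely.
\<close>

lemma tiling_extend:
  assumes \<S>: "shape_family \<S>" and \<T>: "tiling \<S> e \<T>" and S: "S \<in> \<S>" and e: "e \<le> 1"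
  obtains \<T>' where "tiling \<S> e \<T>'" "\<Union>(snd ` \<T>) \<subseteq> \<Union>(snd ` \<T>')"
    "\<And>c. c \<in> carrier G \<Longrightarrow> e * real (card S) \<le> real (card ((S #> c) \<inter> \<Union>(snd ` \<T>')))"
proof -
  define gs where "gs = from_nat_into (carrier G)"
  have gs: "range gs = carrier G"
    unfolding gs_def by (rule range_from_nat_into) (use countable_carrier in auto)
  have gsc: "gs n \<in> carrier G" for n using gs by blast
  note SD = shape_familyD[OF \<S> S]
  define W where "W n = S #> gs n" for n
  have W: "W n \<in> \<S>" "card (W n) = card S" "finite (W n)" for n
    unfolding W_def using SD gsc shape_familyD(1)[OF \<S>] by (auto simp: card_r_coset)
  define U where "U = \<Union>(snd ` \<T>)"
  define V where "V = rec_nat U (\<lambda>n X. if real (card (W n \<inter> X)) \<le> e * real (card S) then X \<union> W n else X)"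
  define J where "J = {n. real (card (W n \<inter> V n)) \<le> e * real (card S)}"
  have V0: "V 0 = U" and VS: "V (Suc n) = (if n \<in> J then V n \<union> W n else V n)" for n
    by (auto simp: V_def J_def)
  have Vmono: "m \<le> n \<Longrightarrow> V m \<subseteq> V n" for m n
    by (rule lift_Suc_mono_le[of V]) (auto simp: VS)
  define \<T>' where "\<T>' = \<T> \<union> (\<lambda>n. (W n, W n - V n)) ` J"
  define U' where "U' = \<Union>(snd ` \<T>')"
  have U': "U' = U \<union> (\<Union>n\<in>J. W n - V n)" unfolding U'_def U_def \<T>'_def by auto
  have VU: "V n \<subseteq> U'" for n
  proof (induction n)
    case (Suc n)
    then show ?case unfolding VS using U' by auto
  qed (auto simp: V0 U')
  have WU: "W n \<subseteq> U'" if "n \<in> J" for n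
    using VU[of "Suc n"] that by (auto simp: VS)
  have UV: "U \<subseteq> V n" for n using Vmono[of 0 n] V0 by simp
  obtain D where D: "finite D" "D \<subseteq> carrier G"
    "\<And>T P x y. (T,P) \<in> \<T> \<Longrightarrow> x \<in> T \<Longrightarrow> y \<in> T \<Longrightarrow> x \<otimes> inv y \<in> D"
    using conjunct2[OF conjunct2[OF \<T>[unfolded tiling_def]]] by fast
  define D' where "D' = D \<union> (\<lambda>(x,y). x \<otimes> inv y) ` (S \<times> S)"
  have D': "finite D'" "D' \<subseteq> carrier G"
    using D(1,2) SD(1,3) by (auto simp: D'_def subset_iff)
  have D'W: "x \<otimes> inv y \<in> D'" if xy: "x \<in> W n" "y \<in> W n" for x y n
  proof -
    from xy obtain s t where st: "s \<in> S" "t \<in> S" "x = s \<otimes> gs n" "y = t \<otimes> gs n"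
      unfolding W_def r_coset_image by auto
    then have "s \<in> carrier G" "t \<in> carrier G" using SD by auto
    moreover from this have "gs n \<otimes> (inv gs n \<otimes> inv t) = inv t"
      using gsc[of n] by (simp flip: m_assoc)
    ultimately have "x \<otimes> inv y = s \<otimes> inv t"
      using st gsc[of n] by (simp add: inv_mult_group m_assoc)
    then show ?thesis using st unfolding D'_def by auto
  qed
  have t1: "T \<in> \<S> \<and> P \<subseteq> T \<and> real (card (T - P)) \<le> e * real (card T) \<and> T \<subseteq> U'"
    if "(T,P) \<in> \<T>'" for T P
    using that unfolding \<T>'_def
  proof
    assume TP: "(T,P) \<in> \<T>"
    have "T \<subseteq> U" using tilingD(4)[OF \<T> TP] unfolding U_def .
    then have "T \<subseteq> U'" unfolding U' by (rule le_supI1)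
    then show ?thesis using tilingD(1-3)[OF \<T> TP] by simp
  next
    assume "(T,P) \<in> (\<lambda>n. (W n, W n - V n)) ` J"
    then obtain n where n: "n \<in> J" "T = W n" "P = W n - V n" by auto
    then have "T - P = W n \<inter> V n" by auto
    then show ?thesis using n W WU unfolding J_def by simp
  qed
  have pn: "P \<inter> (W n - V n) = {}" if "(T,P) \<in> \<T>" for T P n
    using that UV[of n] unfolding U_def by fastforce
  have nn: "(W m - V m) \<inter> (W n - V n) = {}" if "m \<in> J" "m < n" for m n
    using that Vmono[of "Suc m" n] by (auto simp: VS)
  have t2: "P \<inter> P' = {}" if A: "(T,P) \<in> \<T>'" "(T',P') \<in> \<T>'" "(T,P) \<noteq> (T',P')" for T P T' P'
  proof (cases "(T,P) \<in> \<T>")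
    case True
    show ?thesis
    proof (cases "(T',P') \<in> \<T>")
      case True
      then show ?thesis using \<open>(T,P) \<in> \<T>\<close> tiling_disjoint[OF \<T>] A by blast
    next
      case False
      then show ?thesis using A pn[OF True] unfolding \<T>'_def by auto
    qed
  next
    case False
    then obtain n where n: "n \<in> J" "T = W n" "P = W n - V n" using A unfolding \<T>'_def by auto
    show ?thesis
    proof (cases "(T',P') \<in> \<T>")
      case True
      then show ?thesis using pn[OF True, of n] n by blast
    next
      case False
      then obtain m where m: "m \<in> J" "T' = W m" "P' = W m - V m" using A unfolding \<T>'_def by auto
      then have "m \<noteq> n" using n A by auto
      then show ?thesis using nn[of m n] nn[of n m] m n by (metis inf_commute linorder_neqE_nat)
    qed
  qed
  have t3: "x \<otimes> inv y \<in> D'" if A: "(T,P) \<in> \<T>'" "x \<in> T" "y \<in> T" for T P x y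
  proof (cases "(T,P) \<in> \<T>")
    case True
    then show ?thesis using D(3) A unfolding D'_def by blast
  next
    case False
    then obtain n where "T = W n" using A(1) unfolding \<T>'_def by auto
    then show ?thesis using D'W A by blast
  qed
  have "tiling \<S> e \<T>'"
    unfolding tiling_def U'_def[symmetric]
  proof (intro conjI exI[of _ D'] D')
    show "\<forall>(T, P)\<in>\<T>'. T \<in> \<S> \<and> P \<subseteq> T \<and> real (card (T - P)) \<le> e * real (card T) \<and> T \<subseteq> U'"
      unfolding Ball_def split_paired_All prod.case using t1 by blast
    show "\<forall>(T, P)\<in>\<T>'. \<forall>(T', P')\<in>\<T>'. (T, P) \<noteq> (T', P') \<longrightarrow> P \<inter> P' = {}"
      unfolding Ball_def split_paired_All prod.case using t2 by blast
    show "\<forall>(T, P)\<in>\<T>'. \<forall>x\<in>T. \<forall>y\<in>T. x \<otimes> inv y \<in> D'"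
      unfolding Ball_def split_paired_All prod.case using t3 by blast
  qed
  moreover have "U \<subseteq> U'" using U' by auto
  moreover have "e * real (card S) \<le> real (card ((S #> c) \<inter> U'))" if c: "c \<in> carrier G" for c
  proof -
    obtain n where n: "c = gs n" using c gs by blast
    show ?thesis
    proof (cases "n \<in> J")
      case True
      then have "W n \<inter> U' = W n" using WU by blast
      then show ?thesis using n W(2)[of n] mult_right_mono[OF e, of "real (card S)"] by (simp add: W_def)
    next
      case False
      then have "e * real (card S) < real (card (W n \<inter> V n))" by (simp add: J_def)
      also have "\<dots> \<le> real (card (W n \<inter> U'))" using VU W by (intro of_nat_mono card_mono) auto
      finally show ?thesis using n by (simp add: W_def)
    qed
  qed
  ultimately show thesis using that unfolding U_def U'_def by blast
qed

text \<open>
  Let \<open>S\<close> be a shape and tile first with shapes much more invariant than \<open>S\<close>, leaving density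
  \<open>d\<close> uncovered.  Those tiles have few points near their boundary, so most covered points \<open>c\<close> have
  \<open>S #> c\<close> inside the covered part.  After adding translates of \<open>S\<close> every \<open>S #> c\<close> is covered to the proportion \<open>e\<close>.
  Averaging over \<open>c\<close> in \<open>E\<close> (double counting) leaves density about \<open>(1 - e) d\<close> uncovered; the weaker
  factor \<open>1 - e/2\<close> absorbs the errors.
\<close>

lemma density_step:
  assumes e: "0 < e" "e \<le> 1/2" and d: "0 < d"
    and IH: "\<And>\<S>. shape_family \<S> \<Longrightarrow> \<exists>\<T>. tiling \<S> e \<T> \<and> density_le (carrier G - \<Union>(snd ` \<T>)) d"
    and \<S>: "shape_family \<S>"
  shows "\<exists>\<T>. tiling \<S> e \<T> \<and> density_le (carrier G - \<Union>(snd ` \<T>)) ((1 - e/2) * d)"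
proof -
  obtain S where S: "S \<in> \<S>" using shape_familyE[OF \<S>, of "{}" 1] by auto
  note SD = shape_familyD[OF \<S> S]
  \<comment> \<open>With this choice \<open>(1 - e) (d + 2 d') \<le> (1 - e/2) d\<close> holds.\<close>
  define d' where "d' = e * d / 4"
  have d': "0 < d'" using e d by (simp add: d'_def)
  define \<S>' where "\<S>' = {T \<in> \<S>. real (card (bd S T)) \<le> d' * real (card T)}"
  have \<S>': "shape_family \<S>'" unfolding \<S>'_def using shape_family_invariant[OF \<S> SD(1,3) d'] .
  obtain \<T>0 where \<T>0: "tiling \<S>' e \<T>0" "density_le (carrier G - \<Union>(snd ` \<T>0)) d"
    using IH[OF \<S>'] by blast
  have "tiling \<S> e \<T>0" by (rule tiling_mono[OF \<T>0(1)]) (auto simp: \<S>'_def)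
  from tiling_extend[OF \<S> this S] e obtain \<T> where \<T>: "tiling \<S> e \<T>"
    "\<Union>(snd ` \<T>0) \<subseteq> \<Union>(snd ` \<T>)"
    "\<And>c. c \<in> carrier G \<Longrightarrow> e * real (card S) \<le> real (card ((S #> c) \<inter> \<Union>(snd ` \<T>)))"
    by auto
  define U where "U = \<Union>(snd ` \<T>0)"
  define V where "V = carrier G - \<Union>(snd ` \<T>)"
  \<comment> \<open>The centres \<open>c\<close> for which \<open>S #> c\<close> is not inside the part covered before \<open>S\<close> is used.\<close>
  define Z where "Z = {c. \<exists>s\<in>S. s \<otimes> c \<notin> U}"
  obtain L C where LC: "finite L" "L \<subseteq> carrier G" "0 \<le> C"
    "\<And>E. finite E \<Longrightarrow> E \<subseteq> carrier G \<Longrightarrow>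
       real (card (E \<inter> (carrier G - U))) \<le> d * real (card E) + C * real (card (bd L E))"
    using \<T>0(2) unfolding density_le_def U_def by blast
  have PZ: "real (card (P \<inter> Z)) \<le> 2 * d' * real (card P)" if "P \<in> snd ` \<T>0" for P
  proof -
    obtain T where TP: "(T,P) \<in> \<T>0" using \<open>P \<in> snd ` \<T>0\<close> by auto
    note D = tilingD[OF \<T>0(1) TP]
    have "finite T" using D(1) shape_familyD[OF \<S>'] by blast
    moreover have "P \<inter> Z \<subseteq> bd S T" using D(2,4) unfolding Z_def U_def bd_def by blast
    ultimately have "card (P \<inter> Z) \<le> card (bd S T)" by (intro card_mono finite_bd)
    moreover have "real (card (bd S T)) \<le> d' * real (card T)" using D(1) unfolding \<S>'_def by simp
    moreover have "d' * real (card T) \<le> d' * (2 * real (card P))"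
      using tile_card_le[OF \<S>' \<T>0(1) TP e(2)] d' by (intro mult_left_mono) auto
    ultimately show ?thesis by simp
  qed
  have "0 \<le> 2 * d'" using d' by simp
  from tiling_card[OF \<S>' \<T>0(1) this PZ]
  obtain L' where L': "finite L'" "L' \<subseteq> carrier G"
    "\<And>E. finite E \<Longrightarrow> E \<subseteq> carrier G \<Longrightarrow>
       real (card (E \<inter> U \<inter> Z)) \<le> 2 * d' * real (card E) + real (card (bd L' E))"
    unfolding U_def by blast
  define M where "M = L \<union> L' \<union> m_inv G ` S"
  have M: "finite M" "M \<subseteq> carrier G" using LC L' SD by (auto simp: M_def)
  have main: "real (card (E \<inter> V)) \<le> (1 - e/2) * d * real (card E) + (C + 2) * real (card (bd M E))"
    if E: "finite E" "E \<subseteq> carrier G" for E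
  proof -
    \<comment> \<open>Translation by \<open>s\<close> almost preserves counts in \<open>E\<close>: only points leaving \<open>E\<close> under \<open>inv s\<close> are lost.\<close>
    have one: "card (E \<inter> V) \<le> card {c\<in>E. s \<otimes> c \<in> V} + card (bd M E)" if s: "s \<in> S" for s
    proof -
      have sc: "s \<in> carrier G" using s SD by auto
      have "card (E \<inter> V - bd M E) \<le> card {c\<in>E. s \<otimes> c \<in> V}"
      proof (rule card_left_translate[of "inv s"])
        fix g assume g: "g \<in> E \<inter> V - bd M E"
        then have "g \<in> carrier G" using E by auto
        then have "s \<otimes> (inv s \<otimes> g) = g" using sc by (simp flip: m_assoc)
        moreover have "inv s \<otimes> g \<in> E" using g s unfolding bd_def M_def by blast
        ultimately show "inv s \<otimes> g \<in> {c\<in>E. s \<otimes> c \<in> V}" using g by simp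
      qed (use sc E in auto)
      moreover have "card (E \<inter> V) \<le> card ((E \<inter> V - bd M E) \<union> bd M E)"
        using E finite_bd by (intro card_mono) auto
      moreover have "card ((E \<inter> V - bd M E) \<union> bd M E) \<le> card (E \<inter> V - bd M E) + card (bd M E)"
        by (rule card_Un_le)
      ultimately show ?thesis by simp
    qed
    have two: "real (card {s\<in>S. s \<otimes> c \<in> V}) \<le> (if c \<in> Z then (1 - e) * real (card S) else 0)"
      if c: "c \<in> E" for c
    proof (cases "c \<in> Z")
      case False
      then have "{s\<in>S. s \<otimes> c \<in> V} = {}" using \<T>(2) unfolding V_def Z_def U_def by blast
      then show ?thesis using False by (simp only: card.empty) simp
    next
      case True
      have cc: "c \<in> carrier G" using c E by auto
      let ?X = "{s\<in>S. s \<otimes> c \<in> \<Union>(snd ` \<T>)}"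
      have "(S #> c) \<inter> \<Union>(snd ` \<T>) = (\<lambda>x. x \<otimes> c) ` ?X"
        unfolding r_coset_image by blast
      then have "card ((S #> c) \<inter> \<Union>(snd ` \<T>)) = card ?X"
        using SD cc by (simp add: card_image inj_on_subset[OF inj_on_mult_right[OF SD(3) cc]])
      moreover have "card {s\<in>S. s \<otimes> c \<in> V} + card ?X = card ({s\<in>S. s \<otimes> c \<in> V} \<union> ?X)"
        using SD by (intro card_Un_disjoint[symmetric]) (auto simp: V_def)
      moreover have "card ({s\<in>S. s \<otimes> c \<in> V} \<union> ?X) \<le> card S"
        using SD by (intro card_mono) auto
      moreover have "e * real (card S) \<le> real (card ((S #> c) \<inter> \<Union>(snd ` \<T>)))" using \<T>(3)[OF cc] .
      ultimately show ?thesis using True by (simp add: left_diff_distrib)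
    qed
    have "real (card S) * real (card (E \<inter> V)) = (\<Sum>s\<in>S. real (card (E \<inter> V)))" by simp
    also have "\<dots> \<le> (\<Sum>s\<in>S. real (card {c\<in>E. s \<otimes> c \<in> V}) + real (card (bd M E)))"
      using one by (intro sum_mono) (metis of_nat_add of_nat_mono)
    also have "\<dots> = (\<Sum>s\<in>S. real (card {c\<in>E. s \<otimes> c \<in> V})) + real (card S) * real (card (bd M E))"
      by (simp add: sum.distrib)
    also have "(\<Sum>s\<in>S. real (card {c\<in>E. s \<otimes> c \<in> V})) = (\<Sum>c\<in>E. real (card {s\<in>S. s \<otimes> c \<in> V}))"
      using sum_multicount_gen[of S E "\<lambda>s c. s \<otimes> c \<in> V" "\<lambda>c. card {s\<in>S. s \<otimes> c \<in> V}"] SD E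
      by (simp flip: of_nat_sum)
    also have "\<dots> \<le> (\<Sum>c\<in>E. if c \<in> Z then (1 - e) * real (card S) else 0)"
      by (rule sum_mono) (rule two)
    also have "\<dots> = real (card S) * ((1 - e) * real (card (E \<inter> Z)))"
      using E by (simp add: sum.If_cases mult_ac)
    finally have "real (card S) * real (card (E \<inter> V))
      \<le> real (card S) * ((1 - e) * real (card (E \<inter> Z)) + real (card (bd M E)))"
      by (simp add: distrib_left)
    moreover have "0 < real (card S)" using SD by (simp add: card_gt_0_iff)
    ultimately have A: "real (card (E \<inter> V)) \<le> (1 - e) * real (card (E \<inter> Z)) + real (card (bd M E))"
      by (simp only: mult_le_cancel_left_pos)
    have "card (E \<inter> Z) \<le> card (E \<inter> (carrier G - U) \<union> E \<inter> U \<inter> Z)"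
      using E by (intro card_mono) auto
    also have "\<dots> \<le> card (E \<inter> (carrier G - U)) + card (E \<inter> U \<inter> Z)" by (rule card_Un_le)
    finally have "real (card (E \<inter> Z)) \<le> real (card (E \<inter> (carrier G - U))) + real (card (E \<inter> U \<inter> Z))"
      by simp
    also have "\<dots> \<le> (d * real (card E) + C * real (card (bd L E))) + (2 * d' * real (card E) + real (card (bd L' E)))"
      using LC(4)[OF E] L'(3)[OF E] by simp
    also have "\<dots> \<le> (d + 2 * d') * real (card E) + (C + 1) * real (card (bd M E))"
    proof -
      have "L \<subseteq> M" "L' \<subseteq> M" by (auto simp: M_def)
      then have "C * real (card (bd L E)) \<le> C * real (card (bd M E))"
        "real (card (bd L' E)) \<le> real (card (bd M E))"
        using card_bd_mult_mono[OF E(1)] card_bd_mono[OF E(1)] LC(3) by auto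
      then show ?thesis by (simp add: distrib_right)
    qed
    finally have B: "real (card (E \<inter> Z)) \<le> (d + 2 * d') * real (card E) + (C + 1) * real (card (bd M E))" .
    have "(1 - e) * real (card (E \<inter> Z)) \<le> (1 - e) * ((d + 2 * d') * real (card E) + (C + 1) * real (card (bd M E)))"
      using B e by (intro mult_left_mono) auto
    also have "\<dots> = ((1 - e) * (d + 2 * d')) * real (card E) + (1 - e) * ((C + 1) * real (card (bd M E)))"
      by (subst distrib_left) (simp only: mult.assoc)
    also have "\<dots> \<le> ((1 - e/2) * d) * real (card E) + (C + 1) * real (card (bd M E))"
    proof (intro add_mono mult_right_mono)
      have "(1 - e) * (d + 2 * d') = (1 - e/2) * d - e * e * d / 2"
        by (simp add: d'_def field_simps)
      then show "(1 - e) * (d + 2 * d') \<le> (1 - e/2) * d" using e d by simp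
      have "0 \<le> (C + 1) * real (card (bd M E))" using LC by simp
      then show "(1 - e) * ((C + 1) * real (card (bd M E))) \<le> (C + 1) * real (card (bd M E))"
        using e by (intro mult_left_le_one_le) auto
    qed simp
    finally show ?thesis using A by (simp add: algebra_simps)
  qed
  have "density_le V ((1 - e/2) * d)"
    unfolding density_le_def
    by (rule exI[of _ M], rule exI[of _ "C + 2"]) (use M LC main in auto)
  then show ?thesis using \<T>(1) unfolding V_def by blast
qed

theorem tiling_exists:
  assumes e: "0 < e" "e \<le> 1/2" and d: "0 < d" and \<S>: "shape_family \<S>"
  obtains \<T> where "tiling \<S> e \<T>" "density_le (carrier G - \<Union>(snd ` \<T>)) d"
proof -
  have step: "shape_family \<S> \<Longrightarrow>
      \<exists>\<T>. tiling \<S> e \<T> \<and> density_le (carrier G - \<Union>(snd ` \<T>)) ((1 - e/2) ^ n)" for n \<S>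
  proof (induction n arbitrary: \<S>)
    case 0
    have "tiling \<S> e {}" by (auto simp: tiling_def)
    moreover have "density_le Z 1" for Z
      unfolding density_le_def
      by (rule exI[of _ "{}"], rule exI[of _ 0]) (auto intro: card_mono)
    ultimately show ?case by auto
  next
    case (Suc n)
    then show ?case using density_step[OF e, of "(1 - e/2) ^ n" \<S>] e by simp
  qed
  obtain n where "(1 - e/2) ^ n < d" using real_arch_pow_inv[OF d, of "1 - e/2"] e by auto
  then show thesis using step[OF \<S>, of n] density_le_mono that by (meson less_imp_le)
qed

section \<open>Colorings that are good on all invariant sets\<close>

text \<open>
  Pieces inherit small boundaries from their tiles: an element of \<open>P\<close> is moved out of \<open>P\<close> either
  by leaving the tile or by entering the small overlap \<open>T - P\<close>.
\<close>

lemma tiling_small_boundary: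
  assumes K: "finite K" "K \<subseteq> carrier G" and \<eta>: "0 < \<eta>" and \<S>: "shape_family \<S>"
  obtains e \<T> where "e \<le> 1/2" "e \<le> \<eta>" "tiling \<S> e \<T>" "density_le (carrier G - \<Union>(snd ` \<T>)) \<eta>"
    "\<And>T P. (T,P) \<in> \<T> \<Longrightarrow> real (card (bd K P)) \<le> \<eta> * real (card P)"
proof -
  define \<S>' where "\<S>' = {T \<in> \<S>. real (card (bd K T)) \<le> \<eta>/4 * real (card T)}"
  have \<S>': "shape_family \<S>'" unfolding \<S>'_def using shape_family_invariant[OF \<S> K, of "\<eta>/4"] \<eta> by simp
  \<comment> \<open>The bound \<open>1/2\<close> keeps every piece at least half as large as its tile.\<close>
  define e where "e = min (1/2) (\<eta> / (4 * (real (card K) + 1)))"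
  have e: "0 < e" "e \<le> 1/2" using \<eta> by (simp add: e_def) (simp only: e_def min.cobounded1)
  have e1: "e * (real (card K) + 1) \<le> \<eta> / 4"
  proof -
    have "e * (real (card K) + 1) \<le> (\<eta> / (4 * (real (card K) + 1))) * (real (card K) + 1)"
      by (intro mult_right_mono) (auto simp: e_def)
    also have "\<dots> = \<eta> / 4" by (simp add: divide_simps)
    finally show ?thesis .
  qed
  have "0 \<le> e * real (card K)" using e by simp
  moreover have "e * real (card K) + e \<le> \<eta> / 4" using e1 by (simp add: distrib_left)
  ultimately have "e \<le> \<eta>" "e * real (card K) \<le> \<eta> / 4" using e(1) \<eta> by linarith+
  then have e2: "e \<le> \<eta>" "real (card K) * e \<le> \<eta> / 4" by (simp_all add: mult.commute)
  obtain \<T> where \<T>: "tiling \<S>' e \<T>" "density_le (carrier G - \<Union>(snd ` \<T>)) \<eta>"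
    using tiling_exists[OF e \<eta> \<S>'] by blast
  have "real (card (bd K P)) \<le> \<eta> * real (card P)" if TP: "(T,P) \<in> \<T>" for T P
  proof -
    note D = tilingD[OF \<T>(1) TP]
    have T: "finite T" "T \<subseteq> carrier G" using D(1) shape_familyD[OF \<S>'] by auto
    have fP: "finite P" using T D finite_subset by blast
    have each: "card {g\<in>P. h \<otimes> g \<in> T - P} \<le> card (T - P)" if "h \<in> K" for h
      by (rule card_left_translate[of h]) (use that K T D in auto)
    have "bd K P \<subseteq> bd K T \<union> (\<Union>h\<in>K. {g\<in>P. h \<otimes> g \<in> T - P})"
      using D(2) unfolding bd_def by blast
    then have "card (bd K P) \<le> card (bd K T \<union> (\<Union>h\<in>K. {g\<in>P. h \<otimes> g \<in> T - P}))"
      using T K fP by (intro card_mono finite_UnI finite_bd finite_UN_I) auto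
    also have "\<dots> \<le> card (bd K T) + card (\<Union>h\<in>K. {g\<in>P. h \<otimes> g \<in> T - P})" by (rule card_Un_le)
    also have "card (\<Union>h\<in>K. {g\<in>P. h \<otimes> g \<in> T - P}) \<le> (\<Sum>h\<in>K. card {g\<in>P. h \<otimes> g \<in> T - P})"
      by (rule card_UN_le[OF K(1)])
    also have "\<dots> \<le> card K * card (T - P)" using each sum_bounded_above[of K _ "card (T - P)"] by simp
    finally have "real (card (bd K P)) \<le> real (card (bd K T)) + real (card K) * real (card (T - P))"
      by (simp flip: of_nat_mult of_nat_add)
    also have "\<dots> \<le> \<eta>/4 * real (card T) + real (card K) * (e * real (card T))"
      using D by (intro add_mono mult_left_mono) (auto simp: \<S>'_def)
    also have "\<dots> = (\<eta>/4 + real (card K) * e) * real (card T)" by (simp add: distrib_right)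
    also have "\<dots> \<le> (\<eta>/2) * (2 * real (card P))"
      using e2 \<eta> tile_card_le[OF \<S>' \<T>(1) TP e(2)] by (intro mult_mono) auto
    finally show ?thesis by simp
  qed
  moreover have "tiling \<S> e \<T>" by (rule tiling_mono[OF \<T>(1)]) (auto simp: \<S>'_def)
  ultimately show thesis using that e e2 \<T>(2) by blast
qed

text \<open>
  A cylinder function on colorings: it reads only the coordinates in \<open>K\<close>, and is bounded by \<open>B\<close>
  on colorings with values in \<open>V\<close>.
\<close>

definition test_fun :: "'a set \<Rightarrow> real \<Rightarrow> 'v set \<Rightarrow> (('a \<Rightarrow> 'v) \<Rightarrow> complex) \<Rightarrow> bool" where
  "test_fun K B V \<psi> \<longleftrightarrow> (\<forall>c c'. (\<forall>h\<in>K. c h = c' h) \<longrightarrow> \<psi> c = \<psi> c') \<and>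
     (\<forall>c. c ` carrier G \<subseteq> V \<longrightarrow> norm (\<psi> c) \<le> B)"

definition test_sum :: "(('a \<Rightarrow> 'v) \<Rightarrow> complex) \<Rightarrow> ('a \<Rightarrow> 'v) \<Rightarrow> 'a set \<Rightarrow> complex" where
  "test_sum \<psi> c E = (\<Sum>g\<in>E. \<psi> (\<lambda>h. c (h \<otimes> g)))"

lemma test_fun_cong: "test_fun K B V \<psi> \<Longrightarrow> (\<And>h. h \<in> K \<Longrightarrow> c h = c' h) \<Longrightarrow> \<psi> c = \<psi> c'"
  unfolding test_fun_def by blast

lemma test_fun_bound:
  assumes "test_fun K B V \<psi>" "c ` carrier G \<subseteq> V" "g \<in> carrier G"
  shows "norm (\<psi> (\<lambda>h. c (h \<otimes> g))) \<le> B"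
proof -
  have "(\<lambda>h. c (h \<otimes> g)) ` carrier G \<subseteq> V" using assms(2,3) by auto
  then show ?thesis using assms(1) unfolding test_fun_def by blast
qed

lemma test_sum_bound:
  assumes "test_fun K B V \<psi>" "c ` carrier G \<subseteq> V" "E \<subseteq> carrier G"
  shows "norm (test_sum \<psi> c E) \<le> B * real (card E)"
proof -
  have "norm (test_sum \<psi> c E) \<le> real (card E) * B"
    unfolding test_sum_def by (rule sum_norm_bound) (use test_fun_bound[OF assms(1,2)] assms(3) in auto)
  then show ?thesis by (simp add: mult.commute)
qed

lemma test_sum_diff:
  assumes \<psi>: "test_fun K B V \<psi>" and c: "c ` carrier G \<subseteq> V" "c' ` carrier G \<subseteq> V"
    and E: "finite E" "E \<subseteq> carrier G" and X: "{g\<in>E. \<exists>h\<in>K. c (h \<otimes> g) \<noteq> c' (h \<otimes> g)} \<subseteq> X" "finite X"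
    and B: "0 \<le> B"
  shows "norm (test_sum \<psi> c E - test_sum \<psi> c' E) \<le> 2 * B * real (card X)"
proof -
  let ?Y = "{g\<in>E. \<exists>h\<in>K. c (h \<otimes> g) \<noteq> c' (h \<otimes> g)}"
  have "\<psi> (\<lambda>h. c (h \<otimes> g)) = \<psi> (\<lambda>h. c' (h \<otimes> g))" if "g \<in> E - ?Y" for g
    by (rule test_fun_cong[OF \<psi>]) (use that in blast)
  then have "test_sum \<psi> c E - test_sum \<psi> c' E = (\<Sum>g\<in>?Y. \<psi> (\<lambda>h. c (h \<otimes> g)) - \<psi> (\<lambda>h. c' (h \<otimes> g)))"
    unfolding test_sum_def sum_subtractf[symmetric] by (intro sum.mono_neutral_right) (use E in auto)
  also have "norm \<dots> \<le> real (card ?Y) * (2 * B)"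
  proof (rule sum_norm_bound)
    fix g assume "g \<in> ?Y"
    then have g: "g \<in> carrier G" using E by auto
    show "norm (\<psi> (\<lambda>h. c (h \<otimes> g)) - \<psi> (\<lambda>h. c' (h \<otimes> g))) \<le> 2 * B"
      using norm_triangle_ineq4[of "\<psi> (\<lambda>h. c (h \<otimes> g))" "\<psi> (\<lambda>h. c' (h \<otimes> g))"]
        test_fun_bound[OF \<psi> c(1) g] test_fun_bound[OF \<psi> c(2) g] by simp
  qed
  also have "\<dots> \<le> real (card X) * (2 * B)"
    using B by (intro mult_right_mono of_nat_mono card_mono X) auto
  finally show ?thesis by (simp add: mult_ac)
qed

text \<open>
  On finite sets of increasing invariance, the averages of the test functions are eventually at
  most \<open>\<epsilon>\<close> up to an arbitrarily small error, wherever these sets lie in the group.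
\<close>

definition null_upto :: "real \<Rightarrow> (('a \<Rightarrow> 'v) \<Rightarrow> complex) set \<Rightarrow> ('a \<Rightarrow> 'v) \<Rightarrow> bool" where
  "null_upto \<epsilon> \<Psi> c \<longleftrightarrow> (\<exists>L C. finite L \<and> L \<subseteq> carrier G \<and> 0 \<le> C \<and>
     (\<forall>E. finite E \<longrightarrow> E \<subseteq> carrier G \<longrightarrow> (\<forall>\<psi>\<in>\<Psi>.
        norm (test_sum \<psi> c E) \<le> \<epsilon> * real (card E) + C * real (card (bd L E)))))"

lemma null_uptoE:
  assumes "null_upto \<epsilon> \<Psi> c"
  obtains L C where "finite L" "L \<subseteq> carrier G" "0 \<le> C"
    "\<And>E \<psi>. finite E \<Longrightarrow> E \<subseteq> carrier G \<Longrightarrow> \<psi> \<in> \<Psi> \<Longrightarrow>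
        norm (test_sum \<psi> c E) \<le> \<epsilon> * real (card E) + C * real (card (bd L E))"
  using assms unfolding null_upto_def by (elim exE conjE) (rule that; (assumption | blast))

text \<open>
  A word on \<open>T\<close> is a coloring of which only the values on \<open>T\<close> and near it matter; keeping it
  total avoids undefined coordinates at the boundary, which changes sums only by a boundary term.
\<close>

definition word :: "'v set \<Rightarrow> (('a \<Rightarrow> 'v) \<Rightarrow> complex) set \<Rightarrow> real \<Rightarrow> 'a set \<Rightarrow> ('a \<Rightarrow> 'v) \<Rightarrow> bool" where
  "word V \<Psi> \<delta> T w \<longleftrightarrow> w ` carrier G \<subseteq> V \<and> (\<forall>\<psi>\<in>\<Psi>. norm (test_sum \<psi> w T) \<le> \<delta> * real (card T))"

definition word_supply :: "'v set \<Rightarrow> (('a \<Rightarrow> 'v) \<Rightarrow> complex) set \<Rightarrow> bool" where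
  "word_supply V \<Psi> \<longleftrightarrow> (\<forall>L \<delta>. finite L \<longrightarrow> L \<subseteq> carrier G \<longrightarrow> 0 < \<delta> \<longrightarrow>
     (\<exists>T w. finite T \<and> T \<noteq> {} \<and> T \<subseteq> carrier G \<and> real (card (bd L T)) \<le> \<delta> * real (card T) \<and>
        word V \<Psi> \<delta> T w))"

lemma word_supplyE:
  assumes "word_supply V \<Psi>" "finite L" "L \<subseteq> carrier G" "0 < \<delta>"
  obtains T w where "finite T" "T \<noteq> {}" "T \<subseteq> carrier G"
    "real (card (bd L T)) \<le> \<delta> * real (card T)" "word V \<Psi> \<delta> T w"
proof -
  have "\<exists>T w. finite T \<and> T \<noteq> {} \<and> T \<subseteq> carrier G \<and> real (card (bd L T)) \<le> \<delta> * real (card T) \<and>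
        word V \<Psi> \<delta> T w"
    using assms(1)[unfolded word_supply_def, rule_format, OF assms(2-4)] .
  then show thesis by (elim exE conjE) (rule that)
qed

lemma shape_family_words:
  assumes sup: "word_supply V \<Psi>" and K: "K \<subseteq> carrier G"
    and \<Psi>: "\<And>\<psi>. \<psi> \<in> \<Psi> \<Longrightarrow> test_fun K B V \<psi>" and \<delta>: "0 < \<delta>"
  shows "shape_family {T. finite T \<and> T \<noteq> {} \<and> T \<subseteq> carrier G \<and> (\<exists>w. word V \<Psi> \<delta> T w)}" (is "shape_family ?\<S>")
proof -
  have 1: "T #> a \<in> ?\<S>" if T: "T \<in> ?\<S>" and a: "a \<in> carrier G" for T a
  proof -
    obtain w where w: "word V \<Psi> \<delta> T w" using T by blast
    have Tc: "T \<subseteq> carrier G" "finite T" "T \<noteq> {}" using T by auto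
    have tot: "test_sum \<psi> (\<lambda>g. w (g \<otimes> inv a)) (T #> a) = test_sum \<psi> w T" if "\<psi> \<in> \<Psi>" for \<psi>
    proof -
      have "test_sum \<psi> (\<lambda>g. w (g \<otimes> inv a)) (T #> a) = (\<Sum>t\<in>T. \<psi> (\<lambda>h. w (h \<otimes> (t \<otimes> a) \<otimes> inv a)))"
        unfolding test_sum_def r_coset_image by (subst sum.reindex[OF inj_on_mult_right[OF Tc(1) a]]) simp
      also have "\<dots> = test_sum \<psi> w T"
        unfolding test_sum_def
      proof (intro sum.cong refl test_fun_cong[OF \<Psi>[OF that]])
        fix t h assume "t \<in> T" "h \<in> K"
        then have "t \<in> carrier G" "h \<in> carrier G" using Tc K by auto
        then show "w (h \<otimes> (t \<otimes> a) \<otimes> inv a) = w (h \<otimes> t)" using a by (simp add: m_assoc)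
      qed
      finally show ?thesis .
    qed
    have "(\<lambda>g. w (g \<otimes> inv a)) ` carrier G \<subseteq> V" using w a unfolding word_def by auto
    then have "word V \<Psi> \<delta> (T #> a) (\<lambda>g. w (g \<otimes> inv a))"
      using w tot Tc a unfolding word_def by (simp add: card_r_coset)
    moreover have "T #> a \<subseteq> carrier G" using r_coset_subset_G[OF Tc(1) a] .
    ultimately show ?thesis using Tc by (auto simp: r_coset_image)
  qed
  have 2: "\<exists>T\<in>?\<S>. real (card (bd L T)) \<le> d * real (card T)"
    if A: "finite L" "L \<subseteq> carrier G" "0 < d" for L d
  proof -
    have "0 < min d \<delta>" using A \<delta> by simp
    then obtain T w where T: "finite T" "T \<noteq> {}" "T \<subseteq> carrier G"
      "real (card (bd L T)) \<le> min d \<delta> * real (card T)" "word V \<Psi> (min d \<delta>) T w"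
      by (rule word_supplyE[OF sup A(1,2)])
    have le: "min d \<delta> * real (card T) \<le> d * real (card T)" "min d \<delta> * real (card T) \<le> \<delta> * real (card T)"
      by (intro mult_right_mono; simp)+
    have "word V \<Psi> \<delta> T w" using T(5) le(2) unfolding word_def by force
    then have "T \<in> ?\<S>" using T by blast
    moreover have "real (card (bd L T)) \<le> d * real (card T)" using T(4) le(1) by linarith
    ultimately show ?thesis by (rule bexI[rotated])
  qed
  show ?thesis unfolding shape_family_def
  proof (intro conjI ballI allI impI)
    show "T #> a \<in> ?\<S>" if "T \<in> ?\<S>" "a \<in> carrier G" for T a using 1[OF that] .
    show "\<exists>T\<in>?\<S>. real (card (bd L T)) \<le> d * real (card T)"
      if "finite L" "L \<subseteq> carrier G" "0 < d" for L d using 2[OF that] .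
  qed blast+
qed

text \<open>
  Tile the group with words and copy the word of each tile onto its piece.  The sum over a piece
  differs from the sum over the whole word by the overlap and the boundary, both of which are small
  parts of the piece.
\<close>

lemma uniform_coloring:
  assumes sup: "word_supply V \<Psi>" and K: "finite K" "K \<subseteq> carrier G"
    and \<Psi>: "\<And>\<psi>. \<psi> \<in> \<Psi> \<Longrightarrow> test_fun K B V \<psi>" and B: "0 \<le> B" and \<kappa>: "0 < \<kappa>"
  obtains c where "c ` carrier G \<subseteq> V" "null_upto \<kappa> \<Psi> c"
proof -
  \<comment> \<open>Pieces contribute \<open>(4 B + 2) \<eta>\<close> and the uncovered part \<open>B \<eta>\<close>.\<close>
  define \<eta> where "\<eta> = \<kappa> / (5 * B + 2)"
  have \<eta>: "0 < \<eta>" using \<kappa> B by (simp add: \<eta>_def)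
  define \<S> where "\<S> = {T. finite T \<and> T \<noteq> {} \<and> T \<subseteq> carrier G \<and> (\<exists>w. word V \<Psi> \<eta> T w)}"
  have \<S>: "shape_family \<S>" unfolding \<S>_def using shape_family_words[OF sup K(2) \<Psi> \<eta>] by blast
  obtain e \<T> where \<T>: "e \<le> 1/2" "e \<le> \<eta>" "tiling \<S> e \<T>" "density_le (carrier G - \<Union>(snd ` \<T>)) \<eta>"
    "\<And>T P. (T,P) \<in> \<T> \<Longrightarrow> real (card (bd K P)) \<le> \<eta> * real (card P)"
    using tiling_small_boundary[OF K \<eta> \<S>] by blast
  define U where "U = \<Union>(snd ` \<T>)"
  obtain v where v: "v \<in> V"
  proof -
    obtain T where "T \<in> \<S>" using shape_familyE[OF \<S>, of "{}" 1] by auto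
    then show thesis using that one_closed unfolding \<S>_def word_def by blast
  qed
  define w where "w T = (SOME w. word V \<Psi> \<eta> T w)" for T
  have w: "word V \<Psi> \<eta> T (w T)" if "T \<in> \<S>" for T
  proof -
    have "\<exists>w. word V \<Psi> \<eta> T w" using that unfolding \<S>_def by blast
    then show ?thesis unfolding w_def by (rule someI_ex)
  qed
  define tile where "tile g = (THE T. \<exists>P. (T,P) \<in> \<T> \<and> g \<in> P)" for g
  have tile: "tile g = T" if "(T,P) \<in> \<T>" "g \<in> P" for g T P
    unfolding tile_def
  proof (rule the_equality)
    show "\<exists>P. (T,P) \<in> \<T> \<and> g \<in> P" using that by blast
    show "T' = T" if "\<exists>P. (T',P) \<in> \<T> \<and> g \<in> P" for T'
      using that \<open>(T,P) \<in> \<T>\<close> \<open>g \<in> P\<close> tiling_disjoint(1)[OF \<T>(3)] by blast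
  qed
  define c where "c g = (if g \<in> U then w (tile g) g else v)" for g
  have cw: "c g = w T g" if "(T,P) \<in> \<T>" "g \<in> P" for g T P
    using tile[OF that] that unfolding c_def U_def by force
  have cV: "c ` carrier G \<subseteq> V"
  proof (intro image_subsetI)
    fix g assume g: "g \<in> carrier G"
    show "c g \<in> V"
    proof (cases "g \<in> U")
      case True
      then obtain T P where "(T,P) \<in> \<T>" "g \<in> P" unfolding U_def by auto
      then show ?thesis using cw w tilingD(1)[OF \<T>(3)] g unfolding word_def by force
    qed (use v in \<open>simp add: c_def\<close>)
  qed
  have piece: "norm (test_sum \<psi> c P) \<le> ((4 * B + 2) * \<eta>) * real (card P)"
    if \<psi>: "\<psi> \<in> \<Psi>" and TP: "(T,P) \<in> \<T>" for \<psi> T P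
  proof -
    note D = tilingD[OF \<T>(3) TP] and SD = shape_familyD[OF \<S>]
    have T: "finite T" "T \<subseteq> carrier G" using D SD by auto
    then have P: "finite P" "P \<subseteq> carrier G" using D finite_subset by auto
    have wT: "w T ` carrier G \<subseteq> V" "norm (test_sum \<psi> (w T) T) \<le> \<eta> * real (card T)"
      using w[OF D(1)] \<psi> unfolding word_def by auto
    have "norm (test_sum \<psi> c P - test_sum \<psi> (w T) P) \<le> 2 * B * real (card (bd K P))"
    proof (rule test_sum_diff[OF \<Psi>[OF \<psi>] cV wT(1) P])
      show "{g \<in> P. \<exists>h\<in>K. c (h \<otimes> g) \<noteq> w T (h \<otimes> g)} \<subseteq> bd K P"
        using cw[OF TP] unfolding bd_def by blast
    qed (use P B finite_bd in auto)
    also have "\<dots> \<le> 2 * B * (\<eta> * real (card P))"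
      using \<T>(5)[OF TP] B by (intro mult_left_mono) auto
    finally have 1: "norm (test_sum \<psi> c P - test_sum \<psi> (w T) P) \<le> 2 * B * \<eta> * real (card P)" by simp
    have "test_sum \<psi> (w T) T = test_sum \<psi> (w T) (T - P) + test_sum \<psi> (w T) P"
      unfolding test_sum_def using D T by (intro sum.subset_diff) auto
    then have "norm (test_sum \<psi> (w T) P) \<le> norm (test_sum \<psi> (w T) T) + norm (test_sum \<psi> (w T) (T - P))"
      using norm_triangle_ineq4[of "test_sum \<psi> (w T) T" "test_sum \<psi> (w T) (T - P)"] by simp
    also have "\<dots> \<le> \<eta> * real (card T) + B * real (card (T - P))"
      using wT T by (intro add_mono test_sum_bound[OF \<Psi>[OF \<psi>]]) auto
    also have "\<dots> \<le> \<eta> * real (card T) + B * (\<eta> * real (card T))"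
    proof (rule add_left_mono, rule mult_left_mono[OF _ B])
      show "real (card (T - P)) \<le> \<eta> * real (card T)"
        using D(3) \<T>(2) mult_right_mono[of e \<eta> "real (card T)"] by simp
    qed
    also have "\<dots> = ((1 + B) * \<eta>) * real (card T)" by (simp add: algebra_simps)
    also have "\<dots> \<le> ((1 + B) * \<eta>) * (2 * real (card P))"
      using tile_card_le[OF \<S> \<T>(3) TP \<T>(1)] B \<eta> by (intro mult_left_mono) auto
    finally have 2: "norm (test_sum \<psi> (w T) P) \<le> ((1 + B) * \<eta>) * (2 * real (card P))" .
    show ?thesis
      using 1 2 norm_triangle_ineq[of "test_sum \<psi> c P - test_sum \<psi> (w T) P" "test_sum \<psi> (w T) P"]
      by (simp add: algebra_simps)
  qed
  obtain L1 where L1: "finite L1" "L1 \<subseteq> carrier G"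
    "\<And>(u :: 'a \<Rightarrow> complex) B k E.
       (\<And>g. g \<in> carrier G \<Longrightarrow> norm (u g) \<le> B) \<Longrightarrow> 0 \<le> k \<Longrightarrow>
       (\<And>T P. (T,P) \<in> \<T> \<Longrightarrow> norm (sum u P) \<le> k * real (card P)) \<Longrightarrow>
       finite E \<Longrightarrow> E \<subseteq> carrier G \<Longrightarrow>
       norm (sum u (E \<inter> \<Union>(snd ` \<T>))) \<le> k * real (card E) + B * real (card (bd L1 E))"
    using tiling_sum[OF \<S> \<T>(3)] by metis
  obtain L2 C where L2: "finite L2" "L2 \<subseteq> carrier G" "0 \<le> C"
    "\<And>E. finite E \<Longrightarrow> E \<subseteq> carrier G \<Longrightarrow>
       real (card (E \<inter> (carrier G - U))) \<le> \<eta> * real (card E) + C * real (card (bd L2 E))"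
    using \<T>(4) unfolding density_le_def U_def by blast
  have main: "norm (test_sum \<psi> c E) \<le> \<kappa> * real (card E) + (B + B * C) * real (card (bd (L1 \<union> L2) E))"
    if E: "finite E" "E \<subseteq> carrier G" and \<psi>: "\<psi> \<in> \<Psi>" for E \<psi>
  proof -
    have "norm (test_sum \<psi> c (E \<inter> U)) \<le> ((4 * B + 2) * \<eta>) * real (card E) + B * real (card (bd L1 E))"
      unfolding test_sum_def U_def
    proof (rule L1(3)[OF _ _ _ E])
      show "norm (\<Sum>g\<in>P. \<psi> (\<lambda>h. c (h \<otimes> g))) \<le> (4 * B + 2) * \<eta> * real (card P)" if "(T,P) \<in> \<T>" for T P
        using piece[OF \<psi> that] unfolding test_sum_def .
    qed (use B \<eta> test_fun_bound[OF \<Psi>[OF \<psi>] cV] in auto)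
    moreover have "B * real (card (bd L1 E)) \<le> B * real (card (bd (L1 \<union> L2) E))"
      using B E by (intro card_bd_mult_mono) auto
    moreover have "norm (test_sum \<psi> c (E - U)) \<le> B * real (card (E \<inter> (carrier G - U)))"
    proof -
      have "E \<inter> (carrier G - U) = E - U" using E by auto
      then show ?thesis using test_sum_bound[OF \<Psi>[OF \<psi>] cV, of "E - U"] E by auto
    qed
    moreover have "B * real (card (E \<inter> (carrier G - U))) \<le> B * (\<eta> * real (card E) + C * real (card (bd L2 E)))"
      using L2(4)[OF E] B by (intro mult_left_mono) auto
    moreover have "C * real (card (bd L2 E)) \<le> C * real (card (bd (L1 \<union> L2) E))"
      using L2(3) E by (intro card_bd_mult_mono) auto
    then have "B * (\<eta> * real (card E) + C * real (card (bd L2 E)))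
      \<le> B * (\<eta> * real (card E) + C * real (card (bd (L1 \<union> L2) E)))"
      using B by (intro mult_left_mono) auto
    moreover have "test_sum \<psi> c E = test_sum \<psi> c (E \<inter> U) + test_sum \<psi> c (E - U)"
      unfolding test_sum_def using E by (intro sum.Int_Diff) auto
    then have "norm (test_sum \<psi> c E) \<le> norm (test_sum \<psi> c (E \<inter> U)) + norm (test_sum \<psi> c (E - U))"
      by (simp add: norm_triangle_ineq)
    ultimately have "norm (test_sum \<psi> c E) \<le> ((4 * B + 2) * \<eta>) * real (card E) + B * real (card (bd (L1 \<union> L2) E))
       + B * (\<eta> * real (card E) + C * real (card (bd (L1 \<union> L2) E)))"
      by linarith
    also have "\<dots> = ((5 * B + 2) * \<eta>) * real (card E) + (B + B * C) * real (card (bd (L1 \<union> L2) E))"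
      by (simp add: algebra_simps)
    also have "(5 * B + 2) * \<eta> = \<kappa>" using B by (simp add: \<eta>_def)
    finally show ?thesis .
  qed
  have "null_upto \<kappa> \<Psi> c"
    unfolding null_upto_def
    by (rule exI[of _ "L1 \<union> L2"], rule exI[of _ "B + B * C"]) (use L1(1,2) L2(1-3) B main in auto)
  then show thesis using that cV by blast
qed

text \<open>
  The set \<open>A\<close> is a union of pieces (and of points outside all of them), so its edge is contained
  in the set \<open>Z\<close> of points that are uncovered or close to the boundary of their piece.  That set has
  small density and depends only on the tiling, which is why \<open>L\<close> and \<open>C\<close> can be fixed before \<open>Q\<close>.  Within
  \<open>E\<close> both \<open>E \<inter> A\<close> and \<open>E - A\<close> then have a boundary controlled by that of \<open>E\<close> and by \<open>Z\<close>, and the linear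
  form of the estimates for \<open>c1\<close> and \<open>c2\<close> applies to them directly.
\<close>

lemma glue_colorings:
  assumes K: "finite K" "K \<subseteq> carrier G" and \<S>: "shape_family \<S>"
    and \<Psi>: "\<And>\<psi>. \<psi> \<in> \<Psi> \<Longrightarrow> test_fun K B V \<psi>" and B: "0 \<le> B" and \<epsilon>: "\<epsilon> < \<epsilon>'"
    and c1: "c1 ` carrier G \<subseteq> V" "null_upto \<epsilon> \<Psi> c1"
    and c2: "c2 ` carrier G \<subseteq> V" "null_upto \<epsilon> \<Psi> c2"
  obtains L C where "finite L" "L \<subseteq> carrier G" "0 \<le> C"
    "\<And>Q. finite Q \<Longrightarrow> Q \<subseteq> carrier G \<Longrightarrow> \<exists>A. finite A \<and> Q \<subseteq> A \<and> A \<subseteq> carrier G \<and>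
       (\<forall>E \<psi>. finite E \<longrightarrow> E \<subseteq> carrier G \<longrightarrow> \<psi> \<in> \<Psi> \<longrightarrow>
          norm (test_sum \<psi> (\<lambda>g. if g \<in> A then c1 g else c2 g) E)
            \<le> \<epsilon>' * real (card E) + C * real (card (bd L E)))"
proof -
  obtain L1 C1 where L1: "finite L1" "L1 \<subseteq> carrier G" "0 \<le> C1"
    "\<And>E \<psi>. finite E \<Longrightarrow> E \<subseteq> carrier G \<Longrightarrow> \<psi> \<in> \<Psi> \<Longrightarrow>
        norm (test_sum \<psi> c1 E) \<le> \<epsilon> * real (card E) + C1 * real (card (bd L1 E))"
    using null_uptoE[OF c1(2)] by metis
  obtain L2 C2 where L2: "finite L2" "L2 \<subseteq> carrier G" "0 \<le> C2"
    "\<And>E \<psi>. finite E \<Longrightarrow> E \<subseteq> carrier G \<Longrightarrow> \<psi> \<in> \<Psi> \<Longrightarrow>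
        norm (test_sum \<psi> c2 E) \<le> \<epsilon> * real (card E) + C2 * real (card (bd L2 E))"
    using null_uptoE[OF c2(2)] by metis
  define N where "N = K \<union> L1 \<union> L2"
  have N: "finite N" "N \<subseteq> carrier G" using K L1 L2 by (auto simp: N_def)
  define C' where "C' = C1 + C2 + 4 * B"
  have C': "0 \<le> C'" using L1 L2 B by (simp add: C'_def)
  \<comment> \<open>\<open>Z\<close> will have density at most \<open>2 \<eta>\<close>, and each of its points costs at most \<open>C'\<close>.\<close>
  define \<eta> where "\<eta> = (\<epsilon>' - \<epsilon>) / (2 * (C' + 1))"
  have \<eta>: "0 < \<eta>" using \<epsilon> C' by (simp add: \<eta>_def)
  obtain e \<T> where \<T>: "e \<le> 1/2" "e \<le> \<eta>" "tiling \<S> e \<T>" "density_le (carrier G - \<Union>(snd ` \<T>)) \<eta>"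
    "\<And>T P. (T,P) \<in> \<T> \<Longrightarrow> real (card (bd N P)) \<le> \<eta> * real (card P)"
    using tiling_small_boundary[OF N \<eta> \<S>] by blast
  define U where "U = \<Union>(snd ` \<T>)"
  \<comment> \<open>Points outside all pieces satisfy this vacuously.\<close>
  define Z where "Z = {g. \<forall>T P. (T,P) \<in> \<T> \<longrightarrow> g \<in> P \<longrightarrow> g \<in> bd N P}"
  obtain L3 C3 where L3: "finite L3" "L3 \<subseteq> carrier G" "0 \<le> C3"
    "\<And>E. finite E \<Longrightarrow> E \<subseteq> carrier G \<Longrightarrow>
       real (card (E \<inter> (carrier G - U))) \<le> \<eta> * real (card E) + C3 * real (card (bd L3 E))"
    using \<T>(4) unfolding density_le_def U_def by blast
  have PZ: "real (card (P \<inter> Z)) \<le> \<eta> * real (card P)" if "P \<in> snd ` \<T>" for P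
  proof -
    obtain T where TP: "(T,P) \<in> \<T>" using \<open>P \<in> snd ` \<T>\<close> by auto
    have "finite P" using tilingD[OF \<T>(3) TP] shape_familyD(1)[OF \<S>] finite_subset by blast
    moreover have "P \<inter> Z \<subseteq> bd N P" using TP unfolding Z_def by blast
    ultimately have "card (P \<inter> Z) \<le> card (bd N P)" by (intro card_mono finite_bd)
    then show ?thesis using \<T>(5)[OF TP] by linarith
  qed
  obtain L4 where L4: "finite L4" "L4 \<subseteq> carrier G"
    "\<And>E. finite E \<Longrightarrow> E \<subseteq> carrier G \<Longrightarrow>
       real (card (E \<inter> U \<inter> Z)) \<le> \<eta> * real (card E) + real (card (bd L4 E))"
    using tiling_card[OF \<S> \<T>(3) less_imp_le[OF \<eta>] PZ] unfolding U_def by blast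
  define L where "L = N \<union> L3 \<union> L4"
  have L: "finite L" "L \<subseteq> carrier G" using N L3 L4 by (auto simp: L_def)
  have Zd: "real (card (E \<inter> Z)) \<le> 2 * \<eta> * real (card E) + (C3 + 1) * real (card (bd L E))"
    if E: "finite E" "E \<subseteq> carrier G" for E
  proof -
    have "card (E \<inter> Z) \<le> card (E \<inter> (carrier G - U) \<union> E \<inter> U \<inter> Z)"
      using E by (intro card_mono) auto
    also have "\<dots> \<le> card (E \<inter> (carrier G - U)) + card (E \<inter> U \<inter> Z)" by (rule card_Un_le)
    finally have "real (card (E \<inter> Z)) \<le> real (card (E \<inter> (carrier G - U))) + real (card (E \<inter> U \<inter> Z))"
      by simp
    moreover have "C3 * real (card (bd L3 E)) \<le> C3 * real (card (bd L E))"
      using L3 E by (intro card_bd_mult_mono) (auto simp: L_def)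
    moreover have "real (card (bd L4 E)) \<le> real (card (bd L E))"
      using card_bd_mono[OF E(1), of L4 L] by (simp add: L_def)
    ultimately show ?thesis using L3(4)[OF E] L4(3)[OF E] by (simp add: distrib_right)
  qed
  define C where "C = C1 + C2 + C' * (C3 + 1)"
  have C: "0 \<le> C" using L1 L2 L3 C' by (simp add: C_def)
  show thesis
  proof (rule that[OF L C])
    fix Q assume Q: "finite Q" "Q \<subseteq> carrier G"
    define A where "A = Q \<union> \<Union>{P \<in> snd ` \<T>. P \<inter> Q \<noteq> {}}"
    have Pfin: "finite P" "P \<subseteq> carrier G" if P: "P \<in> snd ` \<T>" for P
    proof -
      obtain T where "(T,P) \<in> \<T>" using P by auto
      then have "T \<in> \<S>" "P \<subseteq> T" using tilingD[OF \<T>(3)] by auto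
      moreover from this have "finite T" "T \<subseteq> carrier G" using shape_familyD(1,3)[OF \<S>] by auto
      ultimately show "finite P" "P \<subseteq> carrier G" using finite_subset[of P T] by auto
    qed
    have "{P \<in> snd ` \<T>. P \<inter> Q \<noteq> {}} \<subseteq> (\<Union>q\<in>Q. {P \<in> snd ` \<T>. q \<in> P})" by auto
    moreover have "finite {P \<in> snd ` \<T>. q \<in> P}" for q
    proof (cases "{P \<in> snd ` \<T>. q \<in> P} = {}")
      case False
      then obtain P where P: "P \<in> snd ` \<T>" "q \<in> P" by blast
      then have "{P \<in> snd ` \<T>. q \<in> P} \<subseteq> {P}" using tiling_disjoint(2)[OF \<T>(3)] by fastforce
      then show ?thesis by (rule finite_subset) simp
    next
      case True
      show ?thesis unfolding True by simp
    qed
    ultimately have finPP: "finite {P \<in> snd ` \<T>. P \<inter> Q \<noteq> {}}"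
      using Q(1) by (meson finite_UN_I finite_subset)
    have A: "finite A" "Q \<subseteq> A" "A \<subseteq> carrier G"
      unfolding A_def using Q finPP Pfin by auto
    have sat: "P \<subseteq> A \<or> P \<inter> A = {}" if P: "P \<in> snd ` \<T>" for P
    proof (cases "P \<inter> Q = {}")
      case False
      then show ?thesis using P unfolding A_def by blast
    next
      case True
      have "P \<inter> P' = {}" if "P' \<in> snd ` \<T>" "P' \<inter> Q \<noteq> {}" for P'
      proof -
        have "P \<noteq> P'" using True that by auto
        then show ?thesis using P that(1) tiling_disjoint(2)[OF \<T>(3)] by fastforce
      qed
      then show ?thesis using True unfolding A_def by blast
    qed
    \<comment> \<open>Off \<open>Z\<close>, membership in \<open>A\<close> does not change under translation by \<open>N\<close>.\<close>
    have notZ: "h \<otimes> g \<in> A \<longleftrightarrow> g \<in> A" if "g \<notin> Z" "h \<in> N" for g h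
    proof -
      obtain T P where P: "(T,P) \<in> \<T>" "g \<in> P" "g \<notin> bd N P" using \<open>g \<notin> Z\<close> unfolding Z_def by blast
      then have "h \<otimes> g \<in> P" using \<open>h \<in> N\<close> unfolding bd_def by blast
      moreover have "P \<in> snd ` \<T>" using P(1) by force
      ultimately show ?thesis using sat[of P] P(2) by blast
    qed
    define c where "c g = (if g \<in> A then c1 g else c2 g)" for g
    have cV: "c ` carrier G \<subseteq> V" using c1 c2 by (auto simp: c_def)
    \<comment> \<open>The same estimate is needed inside \<open>A\<close> for \<open>c1\<close> and outside \<open>A\<close> for \<open>c2\<close>.\<close>
    have half: "norm (test_sum \<psi> c (E \<inter> X)) \<le> \<epsilon> * real (card (E \<inter> X)) + Ci * real (card (bd L E))
        + (Ci + 2 * B) * real (card (E \<inter> Z))"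
      if E: "finite E" "E \<subseteq> carrier G" and \<psi>: "\<psi> \<in> \<Psi>" and X: "X = A \<or> X = - A"
        and ci: "ci ` carrier G \<subseteq> V" "\<And>g. g \<in> X \<Longrightarrow> c g = ci g"
        and Li: "Li \<subseteq> N" "0 \<le> Ci" "norm (test_sum \<psi> ci (E \<inter> X)) \<le> \<epsilon> * real (card (E \<inter> X)) + Ci * real (card (bd Li (E \<inter> X)))"
      for E \<psi> X ci Ci Li
    proof -
      have EX: "finite (E \<inter> X)" "E \<inter> X \<subseteq> carrier G" using E by auto
      have inX: "h \<otimes> g \<in> X" if "g \<notin> Z" "h \<in> N" "g \<in> X" for g h
        using notZ[OF that(1,2)] that(3) X by auto
      have "norm (test_sum \<psi> c (E \<inter> X) - test_sum \<psi> ci (E \<inter> X)) \<le> 2 * B * real (card (E \<inter> Z))"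
      proof (rule test_sum_diff[OF \<Psi>[OF \<psi>] cV ci(1) EX])
        show "{g \<in> E \<inter> X. \<exists>h\<in>K. c (h \<otimes> g) \<noteq> ci (h \<otimes> g)} \<subseteq> E \<inter> Z"
        proof (intro subsetI IntI; (elim CollectE conjE bexE IntE)?)
          fix g h assume g: "g \<in> E" "g \<in> X" "h \<in> K" "c (h \<otimes> g) \<noteq> ci (h \<otimes> g)"
          then show "g \<in> Z" using inX[of g h] ci(2)[of "h \<otimes> g"] unfolding N_def by blast
        qed
      qed (use E B in auto)
      moreover have "bd Li (E \<inter> X) \<subseteq> bd L E \<union> (E \<inter> Z)"
      proof
        fix g assume "g \<in> bd Li (E \<inter> X)"
        then obtain h where h: "g \<in> E" "g \<in> X" "h \<in> Li" "h \<otimes> g \<notin> E \<inter> X" by (auto simp: bd_def)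
        then have "h \<in> N" "h \<in> L" using Li(1) by (auto simp: L_def)
        then show "g \<in> bd L E \<union> (E \<inter> Z)" using h inX[of g h] unfolding bd_def by blast
      qed
      then have "card (bd Li (E \<inter> X)) \<le> card (bd L E \<union> (E \<inter> Z))"
        using E finite_bd by (intro card_mono) auto
      then have "card (bd Li (E \<inter> X)) \<le> card (bd L E) + card (E \<inter> Z)"
        using card_Un_le order_trans by blast
      then have "Ci * real (card (bd Li (E \<inter> X))) \<le> Ci * (real (card (bd L E)) + real (card (E \<inter> Z)))"
        using Li(2) by (intro mult_left_mono) auto
      ultimately show ?thesis
        using Li(3) norm_triangle_ineq[of "test_sum \<psi> c (E \<inter> X) - test_sum \<psi> ci (E \<inter> X)" "test_sum \<psi> ci (E \<inter> X)"]
        by (simp add: algebra_simps)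
    qed
    have main: "norm (test_sum \<psi> c E) \<le> \<epsilon>' * real (card E) + C * real (card (bd L E))"
      if E: "finite E" "E \<subseteq> carrier G" and \<psi>: "\<psi> \<in> \<Psi>" for E \<psi>
    proof -
      have fX: "finite (E \<inter> X)" "E \<inter> X \<subseteq> carrier G" for X using E by auto
      have "norm (test_sum \<psi> c (E \<inter> A)) \<le> \<epsilon> * real (card (E \<inter> A)) + C1 * real (card (bd L E))
        + (C1 + 2 * B) * real (card (E \<inter> Z))"
        by (rule half[OF E \<psi> _ c1(1) _ _ L1(3) L1(4)[OF fX \<psi>]]) (auto simp: N_def c_def)
      moreover have "norm (test_sum \<psi> c (E \<inter> -A)) \<le> \<epsilon> * real (card (E \<inter> -A)) + C2 * real (card (bd L E))
        + (C2 + 2 * B) * real (card (E \<inter> Z))"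
        by (rule half[OF E \<psi> _ c2(1) _ _ L2(3) L2(4)[OF fX \<psi>]]) (auto simp: N_def c_def)
      moreover have "test_sum \<psi> c E = test_sum \<psi> c (E \<inter> A) + test_sum \<psi> c (E \<inter> -A)"
        unfolding test_sum_def using E sum.Int_Diff[of E _ A] by (simp add: Diff_eq)
      moreover have "card E = card (E \<inter> A) + card (E \<inter> -A)"
        using E card_Int_Diff[of E A] by (simp add: Diff_eq)
      ultimately have "norm (test_sum \<psi> c E) \<le> \<epsilon> * real (card E) + (C1 + C2) * real (card (bd L E)) + C' * real (card (E \<inter> Z))"
        using norm_triangle_ineq[of "test_sum \<psi> c (E \<inter> A)" "test_sum \<psi> c (E \<inter> -A)"]
        by (simp add: C'_def algebra_simps)
      also have "C' * real (card (E \<inter> Z)) \<le> C' * (2 * \<eta> * real (card E) + (C3 + 1) * real (card (bd L E)))"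
        using Zd[OF E] C' by (intro mult_left_mono) auto
      also have "\<epsilon> * real (card E) + (C1 + C2) * real (card (bd L E)) + \<dots>
        = (\<epsilon> + C' * (2 * \<eta>)) * real (card E) + C * real (card (bd L E))"
        by (simp add: C_def algebra_simps)
      also have "\<dots> \<le> \<epsilon>' * real (card E) + C * real (card (bd L E))"
      proof (intro add_mono mult_right_mono order_refl)
        have "C' * (2 * \<eta>) \<le> (C' + 1) * (2 * \<eta>)" using \<eta> by (intro mult_right_mono) auto
        also have "\<dots> = \<epsilon>' - \<epsilon>" using C' by (simp add: \<eta>_def field_simps)
        finally show "\<epsilon> + C' * (2 * \<eta>) \<le> \<epsilon>'" by simp
      qed simp_all
      finally show ?thesis by simp
    qed
    show "\<exists>A. finite A \<and> Q \<subseteq> A \<and> A \<subseteq> carrier G \<and>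
       (\<forall>E \<psi>. finite E \<longrightarrow> E \<subseteq> carrier G \<longrightarrow> \<psi> \<in> \<Psi> \<longrightarrow>
          norm (test_sum \<psi> (\<lambda>g. if g \<in> A then c1 g else c2 g) E)
            \<le> \<epsilon>' * real (card E) + C * real (card (bd L E)))"
      using A main unfolding c_def by blast
  qed
qed

section \<open>A coloring generic along a Folner sequence\<close>

lemma Folner_sets:
  assumes "left_Folner G F"
  shows "finite (F n)" "F n \<noteq> {}" "F n \<subseteq> carrier G" "0 < real (card (F n))"
  using assms by (auto simp: left_Folner_def card_gt_0_iff)

lemma card_bd_le_sum:
  assumes "finite L" "finite E"
  shows "card (bd L E) \<le> (\<Sum>h\<in>L. card {g\<in>E. h \<otimes> g \<notin> E})"
proof -
  have "bd L E = (\<Union>h\<in>L. {g\<in>E. h \<otimes> g \<notin> E})" by (auto simp: bd_def)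
  then show ?thesis using card_UN_le[OF assms(1), of "\<lambda>h. {g\<in>E. h \<otimes> g \<notin> E}"] by simp
qed

lemma Folner_bd:
  assumes F: "left_Folner G F" and L: "finite L" "L \<subseteq> carrier G" and C: "0 \<le> C" and \<epsilon>: "0 < \<epsilon>"
  shows "\<forall>\<^sub>F n in sequentially. C * real (card (bd L (F n))) \<le> \<epsilon> * real (card (F n))"
proof -
  note FD = Folner_sets[OF F]
  define r where "r h n = real (card (sym_diff (F n) (h <# F n))) / real (card (F n))" for h n
  have "(\<lambda>n. r h n) \<longlonglongrightarrow> 0" if "h \<in> L" for h
    using F that L unfolding left_Folner_def r_def by auto
  then have "(\<lambda>n. C * (\<Sum>h\<in>L. r h n)) \<longlonglongrightarrow> C * (\<Sum>h\<in>L. 0)"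
    by (intro tendsto_mult tendsto_const tendsto_sum)
  then have "\<forall>\<^sub>F n in sequentially. C * (\<Sum>h\<in>L. r h n) < \<epsilon>"
    using \<epsilon> by (intro order_tendstoD(2)) auto
  then show ?thesis
  proof eventually_elim
    case (elim n)
    have each: "card {g\<in>F n. h \<otimes> g \<notin> F n} \<le> card (sym_diff (F n) (h <# F n))" if "h \<in> L" for h
    proof (rule card_left_translate[of h])
      show "finite (sym_diff (F n) (h <# F n))" using FD by (auto simp: l_coset_def)
      show "h \<otimes> g \<in> sym_diff (F n) (h <# F n)" if "g \<in> {g\<in>F n. h \<otimes> g \<notin> F n}" for g
        using that by (auto simp: l_coset_def)
    qed (use that L(2) FD(3)[of n] in blast)+
    have "card (bd L (F n)) \<le> (\<Sum>h\<in>L. card {g\<in>F n. h \<otimes> g \<notin> F n})"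
      using card_bd_le_sum L FD by blast
    also have "\<dots> \<le> (\<Sum>h\<in>L. card (sym_diff (F n) (h <# F n)))"
      by (rule sum_mono) (rule each)
    finally have "real (card (bd L (F n))) \<le> (\<Sum>h\<in>L. real (card (sym_diff (F n) (h <# F n))))"
      by (simp flip: of_nat_sum)
    also have "\<dots> = (\<Sum>h\<in>L. r h n) * real (card (F n))"
      using FD(4)[of n] by (simp add: r_def sum_distrib_right)
    finally have "C * real (card (bd L (F n))) \<le> C * ((\<Sum>h\<in>L. r h n) * real (card (F n)))"
      using C by (rule mult_left_mono)
    also have "\<dots> = (C * (\<Sum>h\<in>L. r h n)) * real (card (F n))" by simp
    also have "\<dots> \<le> \<epsilon> * real (card (F n))" using elim by (intro mult_right_mono) auto
    finally show ?case .
  qed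
qed

text \<open>
  An almost invariant set contains a point whose translates by a prescribed finite set \<open>L\<close> all
  stay inside, hence has at least as many elements as \<open>L\<close>.
\<close>

lemma Folner_card:
  assumes F: "left_Folner G F" and inf: "infinite (carrier G)"
  shows "filterlim (\<lambda>n. real (card (F n))) at_top sequentially"
  unfolding filterlim_at_top
proof
  fix Z :: real
  obtain L where L: "finite L" "card L = nat \<lceil>Z\<rceil>" "L \<subseteq> carrier G"
    using infinite_arbitrarily_large[OF inf] by blast
  have "\<forall>\<^sub>F n in sequentially. 1 * real (card (bd L (F n))) \<le> 1/2 * real (card (F n))"
    by (rule Folner_bd[OF F L(1,3)]) auto
  then show "\<forall>\<^sub>F n in sequentially. Z \<le> real (card (F n))"
  proof eventually_elim
    case (elim n)
    note FD = Folner_sets[OF F, of n]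
    have "bd L (F n) \<noteq> F n" using elim FD(4) by auto
    then obtain g where g: "g \<in> F n" "g \<notin> bd L (F n)" using bd_subset by blast
    then have gc: "g \<in> carrier G" using FD by auto
    have "card L \<le> card (F n)"
    proof (rule card_inj_on_le[of "\<lambda>h. h \<otimes> g"])
      show "inj_on (\<lambda>h. h \<otimes> g) L" by (rule inj_on_mult_right[OF L(3) gc])
      show "(\<lambda>h. h \<otimes> g) ` L \<subseteq> F n" using g by (auto simp: bd_def)
    qed (rule FD(1))
    then show ?case using L(2) by linarith
  qed
qed

lemma null_upto_mono:
  assumes "null_upto \<epsilon> \<Psi> c" "\<epsilon> \<le> \<epsilon>'" "\<Psi>' \<subseteq> \<Psi>"
  shows "null_upto \<epsilon>' \<Psi>' c"
proof (rule null_uptoE[OF assms(1)])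
  fix L C assume LC: "finite L" "L \<subseteq> carrier G" "0 \<le> (C::real)"
    and *: "\<And>E \<psi>. finite E \<Longrightarrow> E \<subseteq> carrier G \<Longrightarrow> \<psi> \<in> \<Psi> \<Longrightarrow>
        norm (test_sum \<psi> c E) \<le> \<epsilon> * real (card E) + C * real (card (bd L E))"
  have "norm (test_sum \<psi> c E) \<le> \<epsilon>' * real (card E) + C * real (card (bd L E))"
    if "finite E" "E \<subseteq> carrier G" "\<psi> \<in> \<Psi>'" for E \<psi>
    using *[OF that(1,2), of \<psi>] that(3) assms(3) mult_right_mono[OF assms(2), of "real (card E)"] by auto
  then show ?thesis unfolding null_upto_def using LC by blast
qed

text \<open>
  The recursive choice of the regions.  If \<open>F n\<close> is contained in \<open>A (j + 2)\<close> but not in \<open>A (j + 1)\<close>,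
  then it has been postponed until it is very invariant and meets the neighbourhood of \<open>A j\<close> in a
  small part only; so on most of \<open>F n\<close> the final coloring is the glued coloring of level \<open>j\<close>.
\<close>

theorem generic_coloring:
  fixes V :: "'v set" and \<Psi> :: "nat \<Rightarrow> (('a \<Rightarrow> 'v) \<Rightarrow> complex) set"
  assumes F: "left_Folner G F" and inf: "infinite (carrier G)"
    and K: "\<And>k. finite (K k)" "\<And>k. K k \<subseteq> carrier G"
    and \<Psi>: "\<And>k \<psi>. \<psi> \<in> \<Psi> k \<Longrightarrow> test_fun (K k) (B k) V \<psi>" and B: "\<And>k. 0 \<le> B k"
    and mono: "\<And>k. \<Psi> k \<subseteq> \<Psi> (Suc k)"
    and sup: "\<And>k. word_supply V (\<Psi> k)"
  obtains c where "c ` carrier G \<subseteq> V"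
    "\<And>k \<psi>. \<psi> \<in> \<Psi> k \<Longrightarrow> (\<lambda>n. test_sum \<psi> c (F n) / of_nat (card (F n))) \<longlonglongrightarrow> 0"
proof -
  note FD = Folner_sets[OF F]
  define \<epsilon> where "\<epsilon> k = 1 / real (Suc k)" for k
  have \<epsilon>: "0 < \<epsilon> k" "\<epsilon> (Suc k) \<le> \<epsilon> k" for k by (auto simp: \<epsilon>_def field_simps)
  have \<Psi>mono: "j \<le> k \<Longrightarrow> \<Psi> j \<subseteq> \<Psi> k" for j k using lift_Suc_mono_le[of \<Psi>] mono by blast
  have "\<forall>k. \<exists>c. c ` carrier G \<subseteq> V \<and> null_upto (\<epsilon> k) (\<Psi> k) c"
    using uniform_coloring[OF sup K \<Psi> B \<epsilon>(1)] by metis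
  then obtain cs where cs: "\<And>k. cs k ` carrier G \<subseteq> V" "\<And>k. null_upto (\<epsilon> k) (\<Psi> k) (cs k)"
    by metis
  define sep where "sep k L C A \<longleftrightarrow> (\<forall>E \<psi>. finite E \<longrightarrow> E \<subseteq> carrier G \<longrightarrow> \<psi> \<in> \<Psi> k \<longrightarrow>
          norm (test_sum \<psi> (\<lambda>g. if g \<in> A then cs k g else cs (Suc k) g) E)
            \<le> 2 * \<epsilon> k * real (card E) + C * real (card (bd L E)))" for k L C A
  have "\<forall>k. \<exists>L C. finite L \<and> L \<subseteq> carrier G \<and> 0 \<le> C \<and>
    (\<forall>Q. finite Q \<longrightarrow> Q \<subseteq> carrier G \<longrightarrow> (\<exists>A. finite A \<and> Q \<subseteq> A \<and> A \<subseteq> carrier G \<and> sep k L C A))"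
  proof
    fix k
    have null: "null_upto (\<epsilon> k) (\<Psi> k) (cs (Suc k))"
      by (rule null_upto_mono[OF cs(2)]) (use \<epsilon> mono in auto)
    have lt: "\<epsilon> k < 2 * \<epsilon> k" using \<epsilon>[of k] by simp
    have shapes: "shape_family {T. finite T \<and> T \<noteq> {} \<and> T \<subseteq> carrier G \<and> (\<exists>w. word V (\<Psi> k) 1 T w)}"
      by (rule shape_family_words[OF sup K(2) \<Psi> zero_less_one])
    have "\<exists>L C. finite L \<and> L \<subseteq> carrier G \<and> 0 \<le> C \<and>
      (\<forall>Q. finite Q \<longrightarrow> Q \<subseteq> carrier G \<longrightarrow> (\<exists>A. finite A \<and> Q \<subseteq> A \<and> A \<subseteq> carrier G \<and> sep k L C A))"
      unfolding sep_def
    proof (rule glue_colorings[OF K(1)[of k] K(2)[of k] shapes \<Psi>[of _ k] B[of k] lt cs(1)[of k] cs(2)[of k] cs(1)[of "Suc k"] null])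
      fix L C
      assume LC: "finite L" "L \<subseteq> carrier G" "0 \<le> (C::real)"
        and Q: "\<And>Q. finite Q \<Longrightarrow> Q \<subseteq> carrier G \<Longrightarrow> \<exists>A. finite A \<and> Q \<subseteq> A \<and> A \<subseteq> carrier G \<and>
          (\<forall>E \<psi>. finite E \<longrightarrow> E \<subseteq> carrier G \<longrightarrow> \<psi> \<in> \<Psi> k \<longrightarrow>
            norm (test_sum \<psi> (\<lambda>g. if g \<in> A then cs k g else cs (Suc k) g) E)
              \<le> 2 * \<epsilon> k * real (card E) + C * real (card (bd L E)))"
      show "\<exists>L C. finite L \<and> L \<subseteq> carrier G \<and> 0 \<le> C \<and>
        (\<forall>Q. finite Q \<longrightarrow> Q \<subseteq> carrier G \<longrightarrow> (\<exists>A. finite A \<and> Q \<subseteq> A \<and> A \<subseteq> carrier G \<and>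
          (\<forall>E \<psi>. finite E \<longrightarrow> E \<subseteq> carrier G \<longrightarrow> \<psi> \<in> \<Psi> k \<longrightarrow>
            norm (test_sum \<psi> (\<lambda>g. if g \<in> A then cs k g else cs (Suc k) g) E)
              \<le> 2 * \<epsilon> k * real (card E) + C * real (card (bd L E)))))"
        by (intro exI[of _ L] exI[of _ C] conjI allI impI LC Q)
    qed
    then show "\<exists>L C. finite L \<and> L \<subseteq> carrier G \<and> 0 \<le> C \<and>
      (\<forall>Q. finite Q \<longrightarrow> Q \<subseteq> carrier G \<longrightarrow> (\<exists>A. finite A \<and> Q \<subseteq> A \<and> A \<subseteq> carrier G \<and> sep k L C A))" .
  qed
  then obtain L C where L: "\<And>k. finite (L k)" "\<And>k. L k \<subseteq> carrier G" "\<And>k. 0 \<le> C k"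
    "\<And>k Q. finite Q \<Longrightarrow> Q \<subseteq> carrier G \<Longrightarrow> \<exists>A. finite A \<and> Q \<subseteq> A \<and> A \<subseteq> carrier G \<and> sep k (L k) (C k) A"
    by metis
  define near where "near k A n = {g\<in>F n. \<exists>h\<in>K k. h \<otimes> g \<in> A}" for k A n
  \<comment> \<open>\<open>F n\<close> is invariant enough for level \<open>k\<close>, and \<open>A\<close> occupies a negligible part of it.\<close>
  define good where "good k A n \<longleftrightarrow>
      C k * real (card (bd (L k) (F n))) \<le> \<epsilon> k * real (card (F n)) \<and>
      B k * real (card (bd (K k) (F n))) \<le> \<epsilon> k * real (card (F n)) \<and>
      B k * real (card (near k A n)) \<le> \<epsilon> k * real (card (F n))" for k A n
  have ev_good: "\<forall>\<^sub>F n in sequentially. good k A n" if A: "finite A" for k A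
  proof -
    have "\<forall>\<^sub>F n in sequentially. B k * real (card (K k) * card A) / \<epsilon> k \<le> real (card (F n))"
      using Folner_card[OF F inf] unfolding filterlim_at_top by blast
    then have "\<forall>\<^sub>F n in sequentially. B k * real (card (near k A n)) \<le> \<epsilon> k * real (card (F n))"
    proof eventually_elim
      case (elim n)
      have "near k A n = (\<Union>h\<in>K k. {g\<in>F n. h \<otimes> g \<in> A})" by (auto simp: near_def)
      then have "card (near k A n) \<le> (\<Sum>h\<in>K k. card {g\<in>F n. h \<otimes> g \<in> A})"
        using card_UN_le[OF K(1)[of k], of "\<lambda>h. {g\<in>F n. h \<otimes> g \<in> A}"] by simp
      also have "\<dots> \<le> (\<Sum>h\<in>K k. card A)"
      proof (rule sum_mono)
        fix h assume "h \<in> K k"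
        then have "h \<in> carrier G" using K(2) by blast
        then show "card {g\<in>F n. h \<otimes> g \<in> A} \<le> card A"
          by (rule card_left_translate) (use A FD(3)[of n] in auto)
      qed
      finally have "card (near k A n) \<le> card (K k) * card A" by simp
      then have "real (card (near k A n)) \<le> real (card (K k) * card A)" by (rule of_nat_mono)
      then have "B k * real (card (near k A n)) \<le> B k * real (card (K k) * card A)"
        using B by (rule mult_left_mono)
      also have "\<dots> \<le> \<epsilon> k * real (card (F n))" using elim \<epsilon>(1)[of k] by (simp add: divide_le_eq mult.commute)
      finally show ?case .
    qed
    then show ?thesis
      using Folner_bd[OF F L(1,2,3) \<epsilon>(1), of k k] Folner_bd[OF F K(1,2) B \<epsilon>(1), of k k k]
      unfolding good_def by (simp add: eventually_conj_iff)
  qed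
  define step where "step k A A' \<longleftrightarrow> A \<subseteq> A' \<and> F k \<subseteq> A' \<and> sep k (L k) (C k) A' \<and> (\<forall>n. F n \<subseteq> A' \<or> good k A n)" for k A A'
  have "\<exists>A. \<forall>k. (finite (A k) \<and> A k \<subseteq> carrier G) \<and> step k (A k) (A (Suc k))"
  proof (rule dependent_nat_choice)
    show "\<exists>A. finite A \<and> A \<subseteq> carrier G" by (rule exI[of _ "{}"]) simp
    fix A k assume A: "finite A \<and> A \<subseteq> carrier G"
    then obtain N where N: "\<And>n. n \<ge> N \<Longrightarrow> good k A n"
      using ev_good[of A k] unfolding eventually_sequentially by blast
    have "finite (A \<union> F k \<union> (\<Union>n<N. F n))" "A \<union> F k \<union> (\<Union>n<N. F n) \<subseteq> carrier G"
      using A FD by auto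
    \<comment> \<open>\<open>A'\<close> swallows the finitely many \<open>F n\<close> that are not good relative to \<open>A\<close>.\<close>
    from L(4)[OF this, of k] obtain A' where A': "finite A'" "A \<union> F k \<union> (\<Union>n<N. F n) \<subseteq> A'"
      "A' \<subseteq> carrier G" "sep k (L k) (C k) A'" by blast
    have "F n \<subseteq> A' \<or> good k A n" for n
      using N[of n] A'(2) by (cases "n < N") auto
    then show "\<exists>A'. (finite A' \<and> A' \<subseteq> carrier G) \<and> step k A A'"
      using A' unfolding step_def by blast
  qed
  then obtain A where A: "\<And>k. finite (A k)" "\<And>k. step k (A k) (A (Suc k))" by blast
  have Amono: "j \<le> k \<Longrightarrow> A j \<subseteq> A k" for j k
    by (rule lift_Suc_mono_le[of A]) (use A(2) in \<open>auto simp: step_def\<close>)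
  \<comment> \<open>Level \<open>k\<close> is used on \<open>A (Suc k) - A k\<close>; points in no \<open>A k\<close> receive an arbitrary color from \<open>V\<close>.\<close>
  define c where "c g = cs (LEAST k. g \<in> A (Suc k)) g" for g
  have cV: "c ` carrier G \<subseteq> V" using cs(1) unfolding c_def by blast
  have c_eq: "c g = (if g \<in> A (Suc j) then cs j g else cs (Suc j) g)"
    if g: "g \<in> A (Suc (Suc j))" "g \<notin> A j" for g j
  proof -
    have ge: "j \<le> k" if "g \<in> A (Suc k)" for k
    proof (rule ccontr)
      assume "\<not> j \<le> k"
      then show False using Amono[of "Suc k" j] that g by auto
    qed
    show ?thesis
    proof (cases "g \<in> A (Suc j)")
      case True
      then have "(LEAST k. g \<in> A (Suc k)) = j" by (intro Least_equality ge)
      then show ?thesis using True by (simp add: c_def)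
    next
      case False
      have "(LEAST k. g \<in> A (Suc k)) = Suc j"
      proof (rule Least_equality)
        show "Suc j \<le> k" if "g \<in> A (Suc k)" for k
          using ge[OF that] False that by (metis le_antisym not_less_eq_eq)
      qed (rule g)
      then show ?thesis using False by (simp add: c_def)
    qed
  qed
  \<comment> \<open>Of the factor 7, two come from the glued coloring, one from its boundary term, and four from the places where \<open>c\<close> differs from it.\<close>
  have bound: "norm (test_sum \<psi> c (F n)) \<le> 7 * \<epsilon> j * real (card (F n))"
    if n: "\<not> F n \<subseteq> A (Suc j)" "F n \<subseteq> A (Suc (Suc j))" and \<psi>: "\<psi> \<in> \<Psi> j" for n j \<psi>
  proof -
    define c' where "c' g = (if g \<in> A (Suc j) then cs j g else cs (Suc j) g)" for g
    have c'V: "c' ` carrier G \<subseteq> V" using cs(1)[of j] cs(1)[of "Suc j"] by (auto simp: c'_def)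
    have good: "good j (A j) n" using A(2)[of j] n unfolding step_def by blast
    have "norm (test_sum \<psi> c' (F n)) \<le> 2 * \<epsilon> j * real (card (F n)) + C j * real (card (bd (L j) (F n)))"
    proof -
      have "sep j (L j) (C j) (A (Suc j))" using A(2)[of j] by (simp add: step_def)
      from this[unfolded sep_def, rule_format, OF FD(1,3) \<psi>] show ?thesis unfolding c'_def .
    qed
    moreover have "C j * real (card (bd (L j) (F n))) \<le> \<epsilon> j * real (card (F n))"
      using good by (simp add: good_def)
    moreover have "norm (test_sum \<psi> c (F n) - test_sum \<psi> c' (F n))
        \<le> 2 * B j * real (card (bd (K j) (F n) \<union> near j (A j) n))"
    proof (rule test_sum_diff[OF \<Psi>[OF \<psi>] cV c'V FD(1,3)])
      show "{g \<in> F n. \<exists>h\<in>K j. c (h \<otimes> g) \<noteq> c' (h \<otimes> g)} \<subseteq> bd (K j) (F n) \<union> near j (A j) n"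
      proof (rule subsetI, elim CollectE conjE bexE)
        fix g h assume g: "g \<in> F n" "h \<in> K j" "c (h \<otimes> g) \<noteq> c' (h \<otimes> g)"
        then have "h \<otimes> g \<notin> F n \<or> h \<otimes> g \<in> A j" using c_eq[of "h \<otimes> g" j] n(2) unfolding c'_def by blast
        then show "g \<in> bd (K j) (F n) \<union> near j (A j) n" using g unfolding bd_def near_def by blast
      qed
      show "finite (bd (K j) (F n) \<union> near j (A j) n)" using FD(1) finite_bd by (simp add: near_def)
    qed (rule B)
    moreover have "2 * B j * real (card (bd (K j) (F n) \<union> near j (A j) n))
       \<le> 2 * B j * (real (card (bd (K j) (F n))) + real (card (near j (A j) n)))"
      using B[of j] card_Un_le[of "bd (K j) (F n)" "near j (A j) n"]
      by (intro mult_left_mono) (simp_all flip: of_nat_add)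
    moreover have "B j * real (card (bd (K j) (F n))) \<le> \<epsilon> j * real (card (F n))"
      "B j * real (card (near j (A j) n)) \<le> \<epsilon> j * real (card (F n))"
      using good by (simp_all add: good_def)
    ultimately show ?thesis
      using norm_triangle_sub[of "test_sum \<psi> c (F n)" "test_sum \<psi> c' (F n)"]
      by (simp add: algebra_simps)
  qed
  have "(\<lambda>n. test_sum \<psi> c (F n) / of_nat (card (F n))) \<longlonglongrightarrow> 0" if \<psi>: "\<psi> \<in> \<Psi> k" for k \<psi>
  proof (rule tendstoI)
    fix r :: real assume r: "0 < r"
    obtain m where m: "7 / r < real m" using reals_Archimedean2 by blast
    define j0 where "j0 = max k m"
    have "\<forall>\<^sub>F n in sequentially. real (Suc (card (A (Suc j0)))) \<le> real (card (F n))"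
      using Folner_card[OF F inf] unfolding filterlim_at_top by blast
    then show "\<forall>\<^sub>F n in sequentially. dist (test_sum \<psi> c (F n) / of_nat (card (F n))) 0 < r"
    proof eventually_elim
      case (elim n)
      have notsub: "\<not> F n \<subseteq> A (Suc j0)"
      proof
        assume "F n \<subseteq> A (Suc j0)"
        then have "card (F n) \<le> card (A (Suc j0))" using A(1) by (rule card_mono[rotated])
        then show False using elim by simp
      qed
      define i where "i = (LEAST i. F n \<subseteq> A (Suc i))"
      have "F n \<subseteq> A (Suc n)" using A(2)[of n] by (simp add: step_def)
      then have i: "F n \<subseteq> A (Suc i)" unfolding i_def by (rule LeastI)
      have "j0 < i"
      proof (rule ccontr)
        assume "\<not> j0 < i"
        then show False using Amono[of "Suc i" "Suc j0"] i notsub by auto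
      qed
      then obtain j where j: "i = Suc j" "j0 \<le> j" by (cases i) auto
      have "\<not> F n \<subseteq> A (Suc j)" using not_less_Least[of j "\<lambda>i. F n \<subseteq> A (Suc i)"] j unfolding i_def by simp
      moreover have "\<psi> \<in> \<Psi> j" using \<psi> \<Psi>mono[of k j] j by (auto simp: j0_def)
      ultimately have "norm (test_sum \<psi> c (F n)) \<le> 7 * \<epsilon> j * real (card (F n))"
        using bound i j by blast
      moreover have "7 * \<epsilon> j < r"
      proof -
        have "7 / r < real (Suc j)" using m j by (simp add: j0_def)
        then show ?thesis using r by (simp add: \<epsilon>_def field_simps)
      qed
      then have "7 * \<epsilon> j * real (card (F n)) < r * real (card (F n))"
        using FD(4)[of n] by (rule mult_strict_right_mono)
      ultimately have "norm (test_sum \<psi> c (F n)) < r * real (card (F n))" by linarith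
      then show ?case using FD(4)[of n] by (simp add: norm_divide divide_less_eq)
    qed
  qed
  then show thesis using that cV by blast
qed

end

section \<open>Words from a measure preserving action\<close>

text \<open>
  The sum of the inner products of \<open>v i\<close> and \<open>\<Phi> i x\<close> has integral \<open>0\<close> as a function of \<open>x\<close>, so it
  is nonpositive at some admissible \<open>x\<close>; expanding the squares gives the bound.
\<close>

lemma (in prob_space) greedy_sample:
  fixes \<Phi> :: "'i \<Rightarrow> 'a \<Rightarrow> complex" and v :: "'i \<Rightarrow> complex"
  assumes P: "AE x in M. P x"
    and meas: "\<And>i. i \<in> I \<Longrightarrow> \<Phi> i \<in> borel_measurable M"
    and bnd: "\<And>i x. i \<in> I \<Longrightarrow> P x \<Longrightarrow> norm (\<Phi> i x) \<le> C"
    and int: "\<And>i. i \<in> I \<Longrightarrow> (\<integral>x. \<Phi> i x \<partial>M) = 0"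
  obtains x where "P x" "(\<Sum>i\<in>I. (norm (v i + \<Phi> i x))\<^sup>2) \<le> (\<Sum>i\<in>I. (norm (v i))\<^sup>2) + real (card I) * C\<^sup>2"
proof -
  have integrable: "integrable M (\<Phi> i)" if "i \<in> I" for i
    by (rule integrable_const_bound[of _ C]) (use P bnd[OF that] meas[OF that] in auto)
  have re: "integrable M (\<lambda>x. v i \<bullet> \<Phi> i x)" "(\<integral>x. v i \<bullet> \<Phi> i x \<partial>M) = 0" if "i \<in> I" for i
    using integrable[OF that] int[OF that] by (auto simp: integral_inner_right)
  define s where "s = (\<lambda>x. \<Sum>i\<in>I. v i \<bullet> \<Phi> i x)"
  have s: "integrable M s" "(\<integral>x. s x \<partial>M) = 0" using re by (auto simp: s_def)
  have "\<exists>x. P x \<and> s x \<le> 0"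
  proof (rule ccontr)
    assume "\<nexists>x. P x \<and> s x \<le> 0"
    then have pos: "AE x in M. 0 < s x" using P by (force elim: eventually_mono)
    then have nonneg: "AE x in M. 0 \<le> s x" by (rule eventually_mono) simp
    have "AE x in M. s x = 0" using integral_nonneg_eq_0_iff_AE[OF s(1) nonneg] s(2) by simp
    moreover have "AE x in M. s x \<noteq> 0" using pos by (rule eventually_mono) simp
    ultimately show False by (rule AE_contr)
  qed
  then obtain x where x: "P x" "s x \<le> 0" by blast
  have "(\<Sum>i\<in>I. (norm (v i + \<Phi> i x))\<^sup>2) = (\<Sum>i\<in>I. (norm (v i))\<^sup>2) + 2 * s x + (\<Sum>i\<in>I. (norm (\<Phi> i x))\<^sup>2)"
    by (simp add: s_def power2_norm_eq_inner inner_add_left inner_add_right inner_commute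
        sum.distrib sum_distrib_left algebra_simps)
  moreover have "(\<Sum>i\<in>I. (norm (\<Phi> i x))\<^sup>2) \<le> (\<Sum>i\<in>I. C\<^sup>2)"
    using bnd x(1) by (intro sum_mono power_mono) auto
  ultimately show thesis using that x by simp
qed

text \<open>
  Adding greedily chosen points one by one lets the squared norm of the vector of partial sums grow
  at most linearly in \<open>N\<close>, so the norm itself is of order \<open>sqrt N\<close>.
\<close>

lemma (in prob_space) finite_sample:
  fixes \<Phi> :: "'i \<Rightarrow> 'a \<Rightarrow> complex"
  assumes I: "finite I" and P: "AE x in M. P x"
    and meas: "\<And>i. i \<in> I \<Longrightarrow> \<Phi> i \<in> borel_measurable M"
    and bnd: "\<And>i x. i \<in> I \<Longrightarrow> P x \<Longrightarrow> norm (\<Phi> i x) \<le> C"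
    and int: "\<And>i. i \<in> I \<Longrightarrow> (\<integral>x. \<Phi> i x \<partial>M) = 0" and \<kappa>: "0 < \<kappa>"
  obtains N xs where "0 < (N::nat)" "\<And>j. j < N \<Longrightarrow> P (xs j)"
    "\<And>i. i \<in> I \<Longrightarrow> norm (\<Sum>j<N. \<Phi> i (xs j)) \<le> \<kappa> * real N"
proof -
  define D where "D = real (card I) * C\<^sup>2"
  have ex: "\<exists>xs. (\<forall>j<N. P (xs j)) \<and> (\<Sum>i\<in>I. (norm (\<Sum>j<N. \<Phi> i (xs j)))\<^sup>2) \<le> real N * D" for N :: nat
  proof (induction N)
    case (Suc N)
    then obtain xs where xs: "\<forall>j<N. P (xs j)" "(\<Sum>i\<in>I. (norm (\<Sum>j<N. \<Phi> i (xs j)))\<^sup>2) \<le> real N * D" by blast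
    obtain x where x: "P x"
      "(\<Sum>i\<in>I. (norm ((\<Sum>j<N. \<Phi> i (xs j)) + \<Phi> i x))\<^sup>2) \<le> (\<Sum>i\<in>I. (norm (\<Sum>j<N. \<Phi> i (xs j)))\<^sup>2) + real (card I) * C\<^sup>2"
      by (rule greedy_sample[where v = "\<lambda>i. \<Sum>j<N. \<Phi> i (xs j)", OF P meas bnd int])
    have "(\<Sum>j<Suc N. \<Phi> i ((xs(N := x)) j)) = (\<Sum>j<N. \<Phi> i (xs j)) + \<Phi> i x" for i
      by simp
    then have "(\<Sum>i\<in>I. (norm (\<Sum>j<Suc N. \<Phi> i ((xs(N := x)) j)))\<^sup>2) \<le> real (Suc N) * D"
      using x(2) xs(2) by (simp add: D_def algebra_simps)
    moreover have "\<forall>j<Suc N. P ((xs(N := x)) j)" using xs x by (auto simp: less_Suc_eq)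
    ultimately show ?case by blast
  qed simp
  obtain N :: nat where N: "D / \<kappa>\<^sup>2 < real N" using reals_Archimedean2 by blast
  define N' where "N' = Suc N"
  have N': "D \<le> \<kappa>\<^sup>2 * real N'" "0 < N'"
  proof -
    have "D < real N * \<kappa>\<^sup>2" using N \<kappa> by (simp add: divide_less_eq)
    moreover have "0 < \<kappa>\<^sup>2" using \<kappa> by simp
    moreover have "\<kappa>\<^sup>2 * real N' = real N * \<kappa>\<^sup>2 + \<kappa>\<^sup>2" by (simp add: N'_def algebra_simps)
    ultimately show "D \<le> \<kappa>\<^sup>2 * real N'" by linarith
  qed (simp add: N'_def)
  obtain xs where xs: "\<forall>j<N'. P (xs j)" "(\<Sum>i\<in>I. (norm (\<Sum>j<N'. \<Phi> i (xs j)))\<^sup>2) \<le> real N' * D"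
    using ex by blast
  have "norm (\<Sum>j<N'. \<Phi> i (xs j)) \<le> \<kappa> * real N'" if i: "i \<in> I" for i
  proof (rule power2_le_imp_le)
    have "(norm (\<Sum>j<N'. \<Phi> i (xs j)))\<^sup>2 \<le> (\<Sum>i\<in>I. (norm (\<Sum>j<N'. \<Phi> i (xs j)))\<^sup>2)"
      by (rule member_le_sum[OF i]) (use I in auto)
    also have "\<dots> \<le> real N' * D" by (rule xs)
    also have "\<dots> \<le> real N' * (\<kappa>\<^sup>2 * real N')" using N' by (intro mult_left_mono) auto
    finally show "(norm (\<Sum>j<N'. \<Phi> i (xs j)))\<^sup>2 \<le> (\<kappa> * real N')\<^sup>2"
      by (simp add: power2_eq_square mult_ac)
  qed (use \<kappa> in simp)
  then show thesis using that N'(2) xs(1) by blast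
qed

context countable_group begin

lemma disjoint_translates:
  assumes inf: "infinite (carrier G)" and S: "finite S" "S \<subseteq> carrier G"
  obtains a :: "nat \<Rightarrow> 'a" where "\<And>j. j < N \<Longrightarrow> a j \<in> carrier G"
    "\<And>i j. i < N \<Longrightarrow> j < N \<Longrightarrow> i \<noteq> j \<Longrightarrow> (S #> a i) \<inter> (S #> a j) = {}"
proof -
  have "\<exists>a::nat \<Rightarrow> 'a. (\<forall>j<N. a j \<in> carrier G) \<and> (\<forall>i<N. \<forall>j<N. i \<noteq> j \<longrightarrow> (S #> a i) \<inter> (S #> a j) = {})"
  proof (induction N)
    case (Suc N)
    then obtain a :: "nat \<Rightarrow> 'a" where a: "\<And>j. j < N \<Longrightarrow> a j \<in> carrier G"
      "\<And>i j. i < N \<Longrightarrow> j < N \<Longrightarrow> i \<noteq> j \<Longrightarrow> (S #> a i) \<inter> (S #> a j) = {}" by blast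
    define X where "X = (\<Union>j<N. S #> a j)"
    have "finite ((\<lambda>(s,x). inv s \<otimes> x) ` (S \<times> X))"
      using S by (auto simp: X_def r_coset_image)
    then obtain b where b: "b \<in> carrier G" "b \<notin> (\<lambda>(s,x). inv s \<otimes> x) ` (S \<times> X)"
      using inf by (meson finite_subset subsetI)
    have new: "(S #> b) \<inter> X = {}"
    proof (rule ccontr)
      assume "(S #> b) \<inter> X \<noteq> {}"
      then obtain s where s: "s \<in> S" "s \<otimes> b \<in> X" by (auto simp: r_coset_image)
      then have "inv s \<otimes> (s \<otimes> b) = b" using S b by (simp add: subset_iff flip: m_assoc)
      then show False using s b(2) by (metis (no_types, lifting) SigmaI case_prod_conv image_eqI)
    qed
    have newj: "(S #> b) \<inter> (S #> a j) = {}" if "j < N" for j using new that unfolding X_def by blast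
    have "(S #> (a(N := b)) i) \<inter> (S #> (a(N := b)) j) = {}" if "i < Suc N" "j < Suc N" "i \<noteq> j" for i j
      using that a(2)[of i j] newj[of i] newj[of j] by (auto simp: less_Suc_eq Int_commute)
    moreover have "(a(N := b)) j \<in> carrier G" if "j < Suc N" for j
      using that a(1) b(1) by (auto simp: less_Suc_eq)
    ultimately show ?case by (intro exI[of _ "a(N := b)"]) blast
  qed simp
  then show thesis using that by blast
qed

text \<open>
  Take a very invariant \<open>S\<close> from the sequence, and let \<open>T\<close> be the union of \<open>N\<close> disjoint
  translates \<open>S #> a j\<close>, colored by \<open>t a j \<mapsto> col (\<tau> t (x j))\<close> with the points \<open>x j\<close> provided by sampling.
  The set \<open>T\<close> is as invariant as \<open>S\<close>, and the number of translates is what makes the average over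
  \<open>T\<close> small.
\<close>

theorem word_supply_of_action:
  fixes col :: "'x \<Rightarrow> 'v" and \<tau> :: "'a \<Rightarrow> 'x \<Rightarrow> 'x"
  assumes F: "left_Folner G F" and inf: "infinite (carrier G)" and M: "prob_space M"
    and act: "\<And>g h x. g \<in> carrier G \<Longrightarrow> h \<in> carrier G \<Longrightarrow> P x \<Longrightarrow> \<tau> (g \<otimes> h) x = \<tau> g (\<tau> h x)"
    and AE_P: "AE x in M. P x" and P: "\<And>g x. g \<in> carrier G \<Longrightarrow> P x \<Longrightarrow> P (\<tau> g x)"
    and col: "\<And>x. P x \<Longrightarrow> col x \<in> V"
    and K: "finite K" "K \<subseteq> carrier G" and fin: "finite \<Psi>" and B: "0 \<le> B"
    and \<Psi>: "\<And>\<psi>. \<psi> \<in> \<Psi> \<Longrightarrow> test_fun K B V \<psi>"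
    and meas: "\<And>\<psi> g. \<psi> \<in> \<Psi> \<Longrightarrow> g \<in> carrier G \<Longrightarrow> integrable M (\<lambda>x. \<psi> (\<lambda>h. col (\<tau> h (\<tau> g x))))"
    and int: "\<And>\<psi> g. \<psi> \<in> \<Psi> \<Longrightarrow> g \<in> carrier G \<Longrightarrow> (\<integral>x. \<psi> (\<lambda>h. col (\<tau> h (\<tau> g x))) \<partial>M) = 0"
  shows "word_supply V \<Psi>"
  unfolding word_supply_def
proof (intro allI impI)
  fix L and \<delta> :: real
  assume L: "finite L" "L \<subseteq> carrier G" and \<delta>: "0 < \<delta>"
  interpret prob_space M by (rule M)
  \<comment> \<open>Half of the tolerance is spent on boundary effects (at most \<open>2 B \<delta>'\<close>), half on sampling.\<close>
  define \<delta>' where "\<delta>' = \<delta> / (4 * B + 1)"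
  have \<delta>': "0 < \<delta>'" "\<delta>' \<le> \<delta>" "2 * B * \<delta>' \<le> \<delta> / 2"
    using B \<delta> by (auto simp: \<delta>'_def field_simps)
  have "\<forall>\<^sub>F n in sequentially. 1 * real (card (bd (L \<union> K) (F n))) \<le> \<delta>' * real (card (F n))"
    by (rule Folner_bd[OF F]) (use L K \<delta>' in auto)
  then obtain n where n: "real (card (bd (L \<union> K) (F n))) \<le> \<delta>' * real (card (F n))"
    by (auto simp: eventually_sequentially)
  define S where "S = F n"
  have S: "finite S" "S \<noteq> {}" "S \<subseteq> carrier G" "0 < real (card S)"
    using Folner_sets[OF F, of n] by (auto simp: S_def)
  have bdS: "real (card (bd L S)) \<le> \<delta>' * real (card S)" "real (card (bd K S)) \<le> \<delta>' * real (card S)"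
    using n card_bd_mono[OF S(1), of L "L \<union> K"] card_bd_mono[OF S(1), of K "L \<union> K"]
    by (auto simp: S_def)
  define \<Phi> where "\<Phi> \<psi> = (\<lambda>x. \<Sum>t\<in>S. \<psi> (\<lambda>h. col (\<tau> h (\<tau> t x))))"
    for \<psi> :: "('a \<Rightarrow> 'v) \<Rightarrow> complex"
  have \<Phi>int: "integrable M (\<Phi> \<psi>)" "(\<integral>x. \<Phi> \<psi> x \<partial>M) = 0" if "\<psi> \<in> \<Psi>" for \<psi>
  proof -
    have "integrable M (\<lambda>x. \<psi> (\<lambda>h. col (\<tau> h (\<tau> t x))))" "(\<integral>x. \<psi> (\<lambda>h. col (\<tau> h (\<tau> t x))) \<partial>M) = 0"
      if "t \<in> S" for t
      using meas[OF \<open>\<psi> \<in> \<Psi>\<close>, of t] int[OF \<open>\<psi> \<in> \<Psi>\<close>, of t] S(3) that by auto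
    then show "integrable M (\<Phi> \<psi>)" "(\<integral>x. \<Phi> \<psi> x \<partial>M) = 0" unfolding \<Phi>_def by auto
  qed
  have \<Phi>bnd: "norm (\<Phi> \<psi> x) \<le> B * real (card S)" if \<psi>: "\<psi> \<in> \<Psi>" and x: "P x" for \<psi> x
  proof -
    have "norm (\<Phi> \<psi> x) \<le> real (card S) * B"
      unfolding \<Phi>_def
    proof (rule sum_norm_bound)
      fix t assume "t \<in> S"
      then have "(\<lambda>h. col (\<tau> h (\<tau> t x))) ` carrier G \<subseteq> V" using P x col S(3) by blast
      then show "norm (\<psi> (\<lambda>h. col (\<tau> h (\<tau> t x)))) \<le> B"
        using \<Psi>[OF \<psi>] unfolding test_fun_def by blast
    qed
    then show ?thesis by (simp add: mult.commute)
  qed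
  have pos: "0 < \<delta> / 2 * real (card S)" using \<delta> S by simp
  obtain N xs where N: "0 < (N::nat)" and xs: "\<And>j. j < N \<Longrightarrow> P (xs j)"
    "\<And>\<psi>. \<psi> \<in> \<Psi> \<Longrightarrow> norm (\<Sum>j<N. \<Phi> \<psi> (xs j)) \<le> \<delta> / 2 * real (card S) * real N"
  proof (rule finite_sample[where \<Phi> = \<Phi> and I = \<Psi>, OF fin AE_P borel_measurable_integrable[OF \<Phi>int(1)] \<Phi>bnd \<Phi>int(2) pos])
    fix N xs
    assume "0 < (N::nat)" "\<And>j. j < N \<Longrightarrow> P (xs j)"
      "\<And>\<psi>. \<psi> \<in> \<Psi> \<Longrightarrow> norm (\<Sum>j<N. \<Phi> \<psi> (xs j)) \<le> \<delta> / 2 * real (card S) * real N"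
    then show thesis by (rule that)
  qed
  obtain a where a: "\<And>j. j < N \<Longrightarrow> a j \<in> carrier G"
    "\<And>i j. i < N \<Longrightarrow> j < N \<Longrightarrow> i \<noteq> j \<Longrightarrow> (S #> a i) \<inter> (S #> a j) = {}"
  proof (rule disjoint_translates[OF inf S(1,3), of N])
    fix a :: "nat \<Rightarrow> 'a"
    assume "\<And>j. j < N \<Longrightarrow> a j \<in> carrier G"
      "\<And>i j. i < N \<Longrightarrow> j < N \<Longrightarrow> i \<noteq> j \<Longrightarrow> (S #> a i) \<inter> (S #> a j) = {}"
    then show thesis by (rule that)
  qed
  define T where "T = (\<Union>j<N. S #> a j)"
  have finSa: "finite (S #> a j)" for j using S by (simp add: r_coset_image)
  have Sac: "S #> a j \<subseteq> carrier G" if "j < N" for j using r_coset_subset_G[OF S(3) a(1)[OF that]] .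
  have T: "finite T" "T \<subseteq> carrier G" using finSa Sac by (auto simp: T_def)
  have cardT: "real (card T) = real N * real (card S)"
  proof -
    have "card T = (\<Sum>j<N. card (S #> a j))"
      unfolding T_def using finSa a(2) by (intro card_UN_disjoint) auto
    also have "\<dots> = (\<Sum>j<N. card S)" by (intro sum.cong refl card_r_coset[OF S(3)] a(1)) simp
    finally show ?thesis by simp
  qed
  have "T \<noteq> {}" using cardT N S by auto
  have bdT: "real (card (bd L T)) \<le> \<delta> * real (card T)"
  proof -
    have "bd L T \<subseteq> (\<Union>j<N. bd L (S #> a j))" by (auto simp: bd_def T_def)
    then have "card (bd L T) \<le> card (\<Union>j<N. bd L (S #> a j))"
      using finSa finite_bd by (intro card_mono) auto
    also have "\<dots> \<le> (\<Sum>j<N. card (bd L (S #> a j)))" by (rule card_UN_le) simp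
    also have "\<dots> = (\<Sum>j<N. card (bd L S))"
    proof (intro sum.cong refl)
      fix j assume "j \<in> {..<N}"
      then have "a j \<in> carrier G" using a by simp
      then show "card (bd L (S #> a j)) = card (bd L S)"
        using S(3) L(2) bd_subset[of L S] by (simp add: bd_r_coset card_r_coset subset_trans)
    qed
    finally have "card (bd L T) \<le> N * card (bd L S)" by simp
    then have "real (card (bd L T)) \<le> real (N * card (bd L S))" by (rule of_nat_mono)
    also have "\<dots> = real N * real (card (bd L S))" by simp
    also have "\<dots> \<le> real N * (\<delta>' * real (card S))" using bdS by (intro mult_left_mono) auto
    also have "\<dots> = \<delta>' * real (card T)" by (simp add: cardT)
    also have "\<dots> \<le> \<delta> * real (card T)" using \<delta>' by (intro mult_right_mono) auto
    finally show ?thesis .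
  qed
  define v where "v = col (xs 0)"
  define idx where "idx g = (THE j. j < N \<and> g \<in> S #> a j)" for g
  define w where "w g = (if g \<in> T then col (\<tau> (g \<otimes> inv (a (idx g))) (xs (idx g))) else v)" for g
  have idx: "idx g = j" if "j < N" "g \<in> S #> a j" for g j
    unfolding idx_def
  proof (rule the_equality)
    show "i = j" if "i < N \<and> g \<in> S #> a i" for i
      using that a(2)[of i j] \<open>j < N\<close> \<open>g \<in> S #> a j\<close> by blast
  qed (use that in simp)
  have wj: "w g = col (\<tau> (g \<otimes> inv (a j)) (xs j))" if "j < N" "g \<in> S #> a j" for g j
    using idx[OF that] that by (auto simp: w_def T_def)
  have wV: "w ` carrier G \<subseteq> V"
  proof (rule image_subsetI)
    fix g assume g: "g \<in> carrier G"
    show "w g \<in> V"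
    proof (cases "g \<in> T")
      case True
      then obtain j where j: "j < N" "g \<in> S #> a j" by (auto simp: T_def)
      have "g \<otimes> inv (a j) \<in> carrier G" using g a(1)[OF j(1)] by simp
      then show ?thesis using wj[OF j] col P xs(1)[OF j(1)] by simp
    qed (use N xs col in \<open>simp add: w_def v_def\<close>)
  qed
  have sumT: "norm (test_sum \<psi> w T) \<le> \<delta> * real (card T)" if \<psi>: "\<psi> \<in> \<Psi>" for \<psi>
  proof -
    have each: "norm (test_sum \<psi> w (S #> a j) - \<Phi> \<psi> (xs j)) \<le> \<delta> / 2 * real (card S)" if j: "j < N" for j
    proof -
      define u where "u g = col (\<tau> (g \<otimes> inv (a j)) (xs j))" for g
      have aj: "a j \<in> carrier G" using a j by simp
      have uV: "u ` carrier G \<subseteq> V" using aj col P xs(1)[OF j] by (auto simp: u_def)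
      have "test_sum \<psi> u (S #> a j) = (\<Sum>t\<in>S. \<psi> (\<lambda>h. u (h \<otimes> (t \<otimes> a j))))"
        unfolding test_sum_def r_coset_image by (subst sum.reindex[OF inj_on_mult_right[OF S(3) aj]]) simp
      also have "\<dots> = \<Phi> \<psi> (xs j)"
        unfolding \<Phi>_def
      proof (intro sum.cong refl test_fun_cong[OF \<Psi>[OF \<psi>]])
        fix t h assume "t \<in> S" "h \<in> K"
        then have th: "t \<in> carrier G" "h \<in> carrier G" using S K by auto
        then have "h \<otimes> (t \<otimes> a j) \<otimes> inv (a j) = h \<otimes> t" using aj by (simp add: m_assoc)
        then show "u (h \<otimes> (t \<otimes> a j)) = col (\<tau> h (\<tau> t (xs j)))"
          using act[OF th(2,1) xs(1)[OF j]] by (simp add: u_def)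
      qed
      finally have "\<Phi> \<psi> (xs j) = test_sum \<psi> u (S #> a j)" by simp
      then have "norm (test_sum \<psi> w (S #> a j) - \<Phi> \<psi> (xs j)) = norm (test_sum \<psi> w (S #> a j) - test_sum \<psi> u (S #> a j))"
        by simp
      also have "\<dots> \<le> 2 * B * real (card (bd K (S #> a j)))"
      proof (rule test_sum_diff[OF \<Psi>[OF \<psi>] wV uV finSa Sac[OF j]])
        show "{g \<in> S #> a j. \<exists>h\<in>K. w (h \<otimes> g) \<noteq> u (h \<otimes> g)} \<subseteq> bd K (S #> a j)"
          using wj[OF j] unfolding bd_def u_def by blast
      qed (use finSa finite_bd B in auto)
      also have "card (bd K (S #> a j)) = card (bd K S)"
        using S(3) K(2) aj bd_subset[of K S] by (simp add: bd_r_coset card_r_coset subset_trans)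
      also have "2 * B * real (card (bd K S)) \<le> 2 * B * (\<delta>' * real (card S))"
        using bdS B by (intro mult_left_mono) auto
      also have "\<dots> = (2 * B * \<delta>') * real (card S)" by simp
      also have "\<dots> \<le> \<delta> / 2 * real (card S)" using \<delta>' by (intro mult_right_mono) auto
      finally show ?thesis .
    qed
    have "test_sum \<psi> w T = (\<Sum>j<N. test_sum \<psi> w (S #> a j))"
      unfolding test_sum_def T_def using finSa a(2) by (intro sum.UNION_disjoint) auto
    also have "\<dots> = (\<Sum>j<N. \<Phi> \<psi> (xs j)) + (\<Sum>j<N. test_sum \<psi> w (S #> a j) - \<Phi> \<psi> (xs j))"
      by (simp add: sum_subtractf)
    also have "norm \<dots> \<le> norm (\<Sum>j<N. \<Phi> \<psi> (xs j)) + norm (\<Sum>j<N. test_sum \<psi> w (S #> a j) - \<Phi> \<psi> (xs j))"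
      by (rule norm_triangle_ineq)
    also have "\<dots> \<le> \<delta> / 2 * real (card S) * real N + real (card {..<N}) * (\<delta> / 2 * real (card S))"
      by (intro add_mono xs(2)[OF \<psi>] sum_norm_bound each) simp
    also have "\<dots> = \<delta> * real (card T)" by (simp add: cardT)
    finally show ?thesis .
  qed
  have "word V \<Psi> \<delta> T w" unfolding word_def using wV sumT by blast
  then show "\<exists>T w. finite T \<and> T \<noteq> {} \<and> T \<subseteq> carrier G \<and> real (card (bd L T)) \<le> \<delta> * real (card T) \<and>
        word V \<Psi> \<delta> T w"
    using T \<open>T \<noteq> {}\<close> bdT by blast
qed

end

section \<open>Monomials and the correspondence\<close>

text \<open>
  The system is given by invariance of the measure of images; preimages under \<open>\<tau> g\<close> are images
  under the inverse of \<open>g\<close>.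
\<close>

lemma measure_preserving_distr:
  assumes sys: "measure_preserving_system G M \<tau>" and g: "g \<in> carrier G"
  shows "distr M M (\<tau> g) = M"
proof (rule measure_eqI)
  interpret prob_space M using sys by (simp add: measure_preserving_system_def)
  interpret group_action G "space M" \<tau> using sys by (simp add: measure_preserving_system_def)
  interpret group G using group_hom group_hom.axioms(1) by auto
  fix A assume "A \<in> sets (distr M M (\<tau> g))"
  then have A: "A \<in> sets M" by simp
  have \<tau>: "\<tau> g \<in> M \<rightarrow>\<^sub>M M" using sys g by (simp add: measure_preserving_system_def)
  have "\<tau> g -` A \<inter> space M = \<tau> (inv\<^bsub>G\<^esub> g) ` A"
  proof (intro equalityI subsetI)
    fix x assume x: "x \<in> \<tau> g -` A \<inter> space M"
    then have "\<tau> (inv\<^bsub>G\<^esub> g) (\<tau> g x) = x" using orbit_sym_aux[OF g, of x "\<tau> g x"] by simp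
    then show "x \<in> \<tau> (inv\<^bsub>G\<^esub> g) ` A" using x by (metis IntE imageI vimage_eq)
  next
    fix x assume "x \<in> \<tau> (inv\<^bsub>G\<^esub> g) ` A"
    then obtain y where y: "y \<in> A" "x = \<tau> (inv\<^bsub>G\<^esub> g) y" by auto
    then have ys: "y \<in> space M" using A sets.sets_into_space by blast
    have ig: "inv\<^bsub>G\<^esub> g \<in> carrier G" using g by simp
    have "\<tau> g x = y" using orbit_sym_aux[OF ig ys y(2)[symmetric]] g by simp
    moreover have "x \<in> space M" using element_image[OF ig ys y(2)[symmetric]] .
    ultimately show "x \<in> \<tau> g -` A \<inter> space M" using y by simp
  qed
  moreover have "measure M (\<tau> (inv\<^bsub>G\<^esub> g) ` A) = measure M A"
    using sys g A by (simp add: measure_preserving_system_def)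
  ultimately show "emeasure (distr M M (\<tau> g)) A = emeasure M A"
    using \<tau> A by (simp add: emeasure_distr emeasure_eq_measure)
qed simp

text \<open>
  Powers are encoded by repetition; the flag tells \<open>c\<close> from its complex conjugate.  Monomials thus
  form a countable family, closed under products.
\<close>

definition monomial :: "('g \<times> bool) list \<Rightarrow> ('g \<Rightarrow> complex) \<Rightarrow> complex" where
  "monomial xs c = (\<Prod>(h, b)\<leftarrow>xs. if b then c h else cnj (c h))"

lemma monomial_simps [simp]:
  "monomial [] c = 1"
  "monomial ((h, b) # xs) c = (if b then c h else cnj (c h)) * monomial xs c"
  "monomial (xs @ ys) c = monomial xs c * monomial ys c"
  "monomial (replicate n (h, b)) c = (if b then c h else cnj (c h)) ^ n"
  by (simp_all add: monomial_def)

lemma monomial_concat: "monomial (concat xss) c = (\<Prod>xs\<leftarrow>xss. monomial xs c)"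
  by (induction xss) auto

lemma monomial_cong: "(\<And>h. h \<in> fst ` set xs \<Longrightarrow> c h = c' h) \<Longrightarrow> monomial xs c = monomial xs c'"
  by (induction xs) (auto simp: image_iff split: prod.splits)

lemma norm_monomial_le:
  assumes "\<And>h. h \<in> fst ` set xs \<Longrightarrow> norm (c h) \<le> C" "0 \<le> C"
  shows "norm (monomial xs c) \<le> C ^ length xs"
  using assms
proof (induction xs)
  case (Cons x xs)
  obtain h b where x: "x = (h, b)" by (cases x)
  have "norm (if b then c h else cnj (c h)) \<le> C" using Cons.prems(1)[of h] x by simp
  moreover have "norm (monomial xs c) \<le> C ^ length xs" using Cons by simp
  ultimately have "norm (if b then c h else cnj (c h)) * norm (monomial xs c) \<le> C * C ^ length xs"
    using \<open>0 \<le> C\<close> by (intro mult_mono) auto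
  then show ?case by (simp add: x norm_mult)
qed simp

lemma monomial_measurable:
  assumes "\<And>h. h \<in> fst ` set xs \<Longrightarrow> (\<lambda>x. c x h) \<in> borel_measurable M"
  shows "(\<lambda>x. monomial xs (c x)) \<in> borel_measurable M"
  using assms
proof (induction xs)
  case (Cons x xs)
  obtain h b where x: "x = (h, b)" by (cases x)
  have [measurable]: "(\<lambda>x. c x h) \<in> borel_measurable M" using Cons.prems[of h] x by simp
  then have [measurable]: "(\<lambda>x. cnj (c x h)) \<in> borel_measurable M"
    by (rule borel_measurable_continuous_on[rotated]) (intro continuous_intros)
  have [measurable]: "(\<lambda>x. monomial xs (c x)) \<in> borel_measurable M" using Cons by simp
  show ?case by (cases b) (simp_all add: x)
qed simp

text \<open>
  The predicate \<open>P\<close> singles out the points on whose whole orbit \<open>f\<close> is bounded by its essential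
  bound.  By countability of the group almost every point is of this kind, so colors can be taken from
  the values of \<open>f\<close> at such points: a bounded subset of the range of \<open>f\<close>.
\<close>

lemma (in countable_group) monomial_generic_coloring:
  fixes f :: "'x \<Rightarrow> complex"
  assumes F: "left_Folner G F" and inf: "infinite (carrier G)"
    and sys: "measure_preserving_system G M \<tau>" and f: "f \<in> L_infty M"
  obtains c where "bounded (c ` carrier G)" "c ` carrier G \<subseteq> f ` space M"
    "\<And>xs. fst ` set xs \<subseteq> carrier G \<Longrightarrow>
      (\<lambda>n. 1 / of_nat (card (F n)) * (\<Sum>g\<in>F n. monomial xs (\<lambda>h. c (h \<otimes> g))))
        \<longlonglongrightarrow> (\<integral>x. monomial xs (\<lambda>h. f (\<tau> h x)) \<partial>M)"
proof -
  interpret prob_space M using sys by (simp add: measure_preserving_system_def)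
  interpret A: group_action G "space M" \<tau> using sys by (simp add: measure_preserving_system_def)
  have \<tau>: "\<tau> g \<in> M \<rightarrow>\<^sub>M M" "distr M M (\<tau> g) = M" if "g \<in> carrier G" for g
    using sys that measure_preserving_distr[OF sys that] by (simp_all add: measure_preserving_system_def)
  have fm: "f \<in> borel_measurable M" using f by (simp add: L_infty_def)
  obtain C0 where C0: "AE x in M. norm (f x) \<le> C0" using f by (auto simp: L_infty_def)
  define C where "C = max C0 0"
  have C: "0 \<le> C" and fC: "AE x in M. norm (f x) \<le> C"
    using C0 by (auto simp: C_def elim: eventually_mono)
  define P where "P x \<longleftrightarrow> x \<in> space M \<and> (\<forall>g\<in>carrier G. norm (f (\<tau> g x)) \<le> C)" for x
  define V where "V = f ` {x. P x}"
  have AE_P: "AE x in M. P x"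
  proof -
    have "AE x in M. norm (f (\<tau> g x)) \<le> C" if "g \<in> carrier G" for g
    proof (rule AE_distrD[OF \<tau>(1)[OF that]])
      show "AE x in distr M M (\<tau> g). norm (f x) \<le> C" unfolding \<tau>(2)[OF that] by (rule fC)
    qed
    then have "AE x in M. \<forall>g\<in>carrier G. norm (f (\<tau> g x)) \<le> C"
      by (rule AE_ball_countable'[OF _ countable_carrier])
    then show ?thesis unfolding P_def using AE_space by eventually_elim simp
  qed
  have Pspace: "P x \<Longrightarrow> x \<in> space M" for x by (simp add: P_def)
  have act: "\<tau> (g \<otimes> h) x = \<tau> g (\<tau> h x)" if "g \<in> carrier G" "h \<in> carrier G" "x \<in> space M" for g h x
    using A.composition_rule that by simp
  have \<tau>space: "\<tau> g x \<in> space M" if "g \<in> carrier G" "x \<in> space M" for g x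
    using A.element_image[OF that] by simp
  have P\<tau>: "P (\<tau> g x)" if "g \<in> carrier G" "P x" for g x
    using that \<tau>space unfolding P_def by (auto simp flip: act)
  have fPC: "norm (f x) \<le> C" if "P x" for x
  proof -
    have "\<tau> \<one> x = x" using A.id_eq_one Pspace[OF that] by (metis restrict_apply')
    then show ?thesis using that one_closed unfolding P_def by metis
  qed
  have VC: "norm v \<le> C" if "v \<in> V" for v using that fPC unfolding V_def by auto
  define m where "m xs = (\<integral>x. monomial xs (\<lambda>h. f (\<tau> h x)) \<partial>M)" for xs
  define \<psi> where "\<psi> xs c = monomial xs c - m xs" for xs c
  define W where "W = lists (carrier G \<times> (UNIV :: bool set))"
  have W: "xs \<in> W \<longleftrightarrow> fst ` set xs \<subseteq> carrier G" for xs
    unfolding W_def by (auto simp: in_lists_conv_set image_subset_iff)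
  have mono_meas: "(\<lambda>x. monomial xs (\<lambda>h. f (\<tau> h x))) \<in> borel_measurable M" if "xs \<in> W" for xs
  proof (rule monomial_measurable)
    fix h assume "h \<in> fst ` set xs"
    then have "h \<in> carrier G" using that W by blast
    then show "(\<lambda>x. f (\<tau> h x)) \<in> borel_measurable M"
      using measurable_compose[OF \<tau>(1) fm] by simp
  qed
  have mono_bnd: "AE x in M. norm (monomial xs (\<lambda>h. f (\<tau> h x))) \<le> C ^ length xs" if "xs \<in> W" for xs
    using AE_P
  proof eventually_elim
    case (elim x)
    show ?case by (rule norm_monomial_le[OF _ C]) (use elim that W in \<open>auto simp: P_def\<close>)
  qed
  have mono_int: "integrable M (\<lambda>x. monomial xs (\<lambda>h. f (\<tau> h x)))" if "xs \<in> W" for xs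
    using integrable_const_bound[OF mono_bnd mono_meas] that by blast
  have m_le: "norm (m xs) \<le> C ^ length xs" if "xs \<in> W" for xs
  proof -
    have "norm (m xs) \<le> (\<integral>x. norm (monomial xs (\<lambda>h. f (\<tau> h x))) \<partial>M)"
      unfolding m_def by (rule integral_norm_bound)
    also have "\<dots> \<le> C ^ length xs"
      by (rule integral_le_const[OF integrable_norm[OF mono_int[OF that]] mono_bnd[OF that]])
    finally show ?thesis .
  qed
  have shift: "integrable M (\<lambda>x. \<psi> xs (\<lambda>h. f (\<tau> h (\<tau> g x))))"
    "(\<integral>x. \<psi> xs (\<lambda>h. f (\<tau> h (\<tau> g x))) \<partial>M) = 0" if xs: "xs \<in> W" and g: "g \<in> carrier G" for xs g
  proof -
    have int: "integrable M (\<lambda>x. monomial xs (\<lambda>h. f (\<tau> h (\<tau> g x))))"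
      by (rule integrable_distr[OF \<tau>(1)[OF g]]) (simp add: \<tau>(2)[OF g] mono_int[OF xs])
    then show "integrable M (\<lambda>x. \<psi> xs (\<lambda>h. f (\<tau> h (\<tau> g x))))" by (simp add: \<psi>_def)
    have "(\<integral>x. monomial xs (\<lambda>h. f (\<tau> h (\<tau> g x))) \<partial>M) = m xs"
      using integral_distr[OF \<tau>(1)[OF g] mono_meas[OF xs]] by (simp add: \<tau>(2)[OF g] m_def)
    then show "(\<integral>x. \<psi> xs (\<lambda>h. f (\<tau> h (\<tau> g x))) \<partial>M) = 0" using int by (simp add: \<psi>_def prob_space)
  qed
  define e where "e = from_nat_into W"
  have e: "range e = W"
    unfolding e_def by (rule range_from_nat_into)
      (use countable_carrier in \<open>auto simp: W_def intro!: countable_lists countable_SIGMA\<close>)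
  then have eW: "e i \<in> W" for i by blast
  define \<Psi> where "\<Psi> k = (\<lambda>i. \<psi> (e i)) ` {..k}" for k :: nat
  define K where "K k = (\<Union>i\<le>k. fst ` set (e i))" for k :: nat
  define B where "B k = (\<Sum>i\<le>k. 2 * C ^ length (e i))" for k :: nat
  have K: "finite (K k)" "K k \<subseteq> carrier G" for k
    unfolding K_def using eW W by blast+
  have B: "0 \<le> B k" for k unfolding B_def using C by (intro sum_nonneg) simp
  have test: "test_fun (K k) (B k) V p" if "p \<in> \<Psi> k" for k p
  proof -
    obtain i where i: "i \<le> k" "p = \<psi> (e i)" using \<open>p \<in> \<Psi> k\<close> unfolding \<Psi>_def by auto
    have sub: "fst ` set (e i) \<subseteq> K k" using i unfolding K_def by blast
    show ?thesis unfolding test_fun_def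
    proof (intro conjI allI impI)
      fix c c' :: "'a \<Rightarrow> complex" assume "\<forall>h\<in>K k. c h = c' h"
      then have "monomial (e i) c = monomial (e i) c'" using sub by (intro monomial_cong) blast
      then show "p c = p c'" by (simp add: i \<psi>_def)
    next
      fix c :: "'a \<Rightarrow> complex" assume c: "c ` carrier G \<subseteq> V"
      have "norm (monomial (e i) c) \<le> C ^ length (e i)"
        by (rule norm_monomial_le[OF _ C]) (use c VC eW[of i] W in blast)
      then have "norm (p c) \<le> 2 * C ^ length (e i)"
        using m_le[OF eW[of i]] norm_triangle_ineq4[of "monomial (e i) c" "m (e i)"] by (simp add: i \<psi>_def)
      also have "\<dots> \<le> B k" unfolding B_def by (rule member_le_sum) (use i C in auto)
      finally show "norm (p c) \<le> B k" .
    qed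
  qed
  have sup: "word_supply V (\<Psi> k)" for k
  proof (rule word_supply_of_action[where \<tau> = \<tau> and col = f and P = P, OF F inf prob_space_axioms _ AE_P P\<tau> _ K _ B test])
    show "finite (\<Psi> k)" by (simp add: \<Psi>_def)
    show "f x \<in> V" if "P x" for x using that by (simp add: V_def)
    show "\<tau> (g \<otimes> h) x = \<tau> g (\<tau> h x)" if "g \<in> carrier G" "h \<in> carrier G" "P x" for g h x
      using act that Pspace by blast
    show "integrable M (\<lambda>x. p (\<lambda>h. f (\<tau> h (\<tau> g x))))" "(\<integral>x. p (\<lambda>h. f (\<tau> h (\<tau> g x))) \<partial>M) = 0"
      if "p \<in> \<Psi> k" "g \<in> carrier G" for p g
      using that shift[OF eW] by (auto simp: \<Psi>_def)
  qed
  have mono: "\<Psi> k \<subseteq> \<Psi> (Suc k)" for k by (auto simp: \<Psi>_def)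
  show thesis
  proof (rule generic_coloring[where V = V and \<Psi> = \<Psi> and K = K and B = B, OF F inf K test B mono sup])
    fix c :: "'a \<Rightarrow> complex"
    assume cV: "c ` carrier G \<subseteq> V"
      and lim: "\<And>k p. p \<in> \<Psi> k \<Longrightarrow> (\<lambda>n. test_sum p c (F n) / of_nat (card (F n))) \<longlonglongrightarrow> 0"
    have "bounded (c ` carrier G)" using cV VC unfolding bounded_iff by blast
    moreover have "c ` carrier G \<subseteq> f ` space M" using cV Pspace unfolding V_def by blast
    moreover have "(\<lambda>n. 1 / of_nat (card (F n)) * (\<Sum>g\<in>F n. monomial xs (\<lambda>h. c (h \<otimes> g)))) \<longlonglongrightarrow> m xs"
      if "fst ` set xs \<subseteq> carrier G" for xs
    proof -
      have "xs \<in> range e" using that e W by simp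
      then obtain i where i: "xs = e i" by blast
      have "\<psi> xs \<in> \<Psi> i" by (simp add: i \<Psi>_def)
      from lim[OF this] have "(\<lambda>n. test_sum (\<psi> xs) c (F n) / of_nat (card (F n)) + m xs) \<longlonglongrightarrow> 0 + m xs"
        by (intro tendsto_add tendsto_const)
      moreover have "test_sum (\<psi> xs) c (F n) / of_nat (card (F n)) + m xs
          = 1 / of_nat (card (F n)) * (\<Sum>g\<in>F n. monomial xs (\<lambda>h. c (h \<otimes> g)))" for n
        using Folner_sets(4)[OF F, of n]
        by (simp add: test_sum_def \<psi>_def sum_subtractf field_simps)
      ultimately show ?thesis by simp
    qed
    ultimately show thesis using that unfolding m_def by blast
  qed
qed

theorem theorem1p2:
  fixes G :: "('g, 'b) monoid_scheme"
    and F :: "nat \<Rightarrow> 'g set"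
    and M :: "'x measure"
    and \<tau> :: "'g \<Rightarrow> 'x \<Rightarrow> 'x"
    and f :: "'x \<Rightarrow> complex"
  assumes "group G"
    and "countable (carrier G)"
    and "infinite (carrier G)"
    and "amenable G"
    and "left_Folner G F"
    and "measure_preserving_system G M \<tau>"
    and "f \<in> L_infty M"
  shows "\<exists>c :: 'g \<Rightarrow> complex.
    bounded (c ` carrier G) \<and>
    c ` carrier G \<subseteq> f ` space M \<and>
    (\<lambda>n. 1 / of_nat (card (F n)) * (\<Sum>g\<in>F n. c g)) \<longlonglongrightarrow> (\<integral>x. f x \<partial>M) \<and>
    (\<forall>h\<in>carrier G.
       (\<lambda>n. 1 / of_nat (card (F n)) * (\<Sum>g\<in>F n. c (h \<otimes>\<^bsub>G\<^esub> g) * cnj (c g)))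
         \<longlonglongrightarrow> L2_inner M (translate \<tau> h f) f) \<and>
    (\<forall>(l::nat) (t :: nat \<Rightarrow> nat) (h :: nat \<Rightarrow> 'g)
       (d :: nat \<Rightarrow> 'g \<Rightarrow> complex) (fs :: nat \<Rightarrow> 'x \<Rightarrow> complex).
       l \<ge> 1 \<longrightarrow>
       (\<forall>i\<in>{1..l}. t i \<ge> 1) \<longrightarrow>
       (\<forall>i\<in>{1..l}. h i \<in> carrier G) \<longrightarrow>
       (\<forall>i\<in>{1..l}. (d i, fs i) \<in> {(c, f), (cnj \<circ> c, cnj \<circ> f)}) \<longrightarrow>
       (\<lambda>n. 1 / of_nat (card (F n)) * (\<Sum>g\<in>F n. \<Prod>i=1..l. d i (h i \<otimes>\<^bsub>G\<^esub> g) ^ t i))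
         \<longlonglongrightarrow> (\<integral>x. (\<Prod>i=1..l. translate \<tau> (h i) (\<lambda>y. fs i y ^ t i) x) \<partial>M))"
proof -
  interpret countable_group G
    by (rule countable_group.intro[OF assms(1)]) (simp add: countable_group_axioms_def assms(2))
  interpret A: group_action G "space M" \<tau> using assms(6) by (simp add: measure_preserving_system_def)
  obtain c where c: "bounded (c ` carrier G)" "c ` carrier G \<subseteq> f ` space M"
    "\<And>xs. fst ` set xs \<subseteq> carrier G \<Longrightarrow>
      (\<lambda>n. 1 / of_nat (card (F n)) * (\<Sum>g\<in>F n. monomial xs (\<lambda>h. c (h \<otimes>\<^bsub>G\<^esub> g))))
        \<longlonglongrightarrow> (\<integral>x. monomial xs (\<lambda>h. f (\<tau> h x)) \<partial>M)"
  proof (rule monomial_generic_coloring[OF assms(5,3,6,7)])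
    fix c
    assume "bounded (c ` carrier G)" "c ` carrier G \<subseteq> f ` space M"
      "\<And>xs. fst ` set xs \<subseteq> carrier G \<Longrightarrow>
      (\<lambda>n. 1 / of_nat (card (F n)) * (\<Sum>g\<in>F n. monomial xs (\<lambda>h. c (h \<otimes>\<^bsub>G\<^esub> g))))
        \<longlonglongrightarrow> (\<integral>x. monomial xs (\<lambda>h. f (\<tau> h x)) \<partial>M)"
    then show thesis by (rule that)
  qed
  have one: "\<one>\<^bsub>G\<^esub> \<otimes>\<^bsub>G\<^esub> g = g" if "g \<in> F n" for g n
    using Folner_sets(3)[OF assms(5), of n] that by auto
  have \<tau>one: "\<tau> \<one>\<^bsub>G\<^esub> x = x" if "x \<in> space M" for x
    using A.id_eq_one that by (metis restrict_apply')
  show ?thesis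
  proof (intro exI[of _ c] conjI ballI allI impI c(1,2))
    have "(\<integral>x. f (\<tau> \<one>\<^bsub>G\<^esub> x) \<partial>M) = (\<integral>x. f x \<partial>M)"
      by (rule Bochner_Integration.integral_cong) (simp_all add: \<tau>one)
    then show "(\<lambda>n. 1 / of_nat (card (F n)) * (\<Sum>g\<in>F n. c g)) \<longlonglongrightarrow> (\<integral>x. f x \<partial>M)"
      using c(3)[of "[(\<one>\<^bsub>G\<^esub>, True)]"] by (simp add: one)
  next
    fix h assume h: "h \<in> carrier G"
    have "(\<integral>x. f (\<tau> h x) * cnj (f (\<tau> \<one>\<^bsub>G\<^esub> x)) \<partial>M) = L2_inner M (translate \<tau> h f) f"
      unfolding L2_inner_def translate_def
      by (rule Bochner_Integration.integral_cong) (simp_all add: \<tau>one)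
    then show "(\<lambda>n. 1 / of_nat (card (F n)) * (\<Sum>g\<in>F n. c (h \<otimes>\<^bsub>G\<^esub> g) * cnj (c g)))
        \<longlonglongrightarrow> L2_inner M (translate \<tau> h f) f"
      using c(3)[of "[(h, True), (\<one>\<^bsub>G\<^esub>, False)]"] h by (simp add: one)
  next
    fix l :: nat and t :: "nat \<Rightarrow> nat" and h :: "nat \<Rightarrow> 'g"
      and d :: "nat \<Rightarrow> 'g \<Rightarrow> complex" and fs :: "nat \<Rightarrow> 'x \<Rightarrow> complex"
    assume h: "\<forall>i\<in>{1..l}. h i \<in> carrier G"
      and d: "\<forall>i\<in>{1..l}. (d i, fs i) \<in> {(c, f), (cnj \<circ> c, cnj \<circ> f)}"
    define b where "b i \<longleftrightarrow> (d i, fs i) = (c, f)" for i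
    define xs where "xs = concat (map (\<lambda>i. replicate (t i) (h i, b i)) [1..<Suc l])"
    have mono_xs: "monomial xs u = (\<Prod>i=1..l. (if b i then u (h i) else cnj (u (h i))) ^ t i)" for u
      unfolding xs_def monomial_concat map_map comp_def monomial_simps
      by (simp add: prod.distinct_set_conv_list[symmetric] atLeastLessThanSuc_atLeastAtMost del: upt_Suc)
    have cd: "(if b i then c g else cnj (c g)) = d i g" "(if b i then f y else cnj (f y)) = fs i y"
      if "i \<in> {1..l}" for i g y
      using d that by (auto simp: b_def)
    have "fst ` set xs \<subseteq> carrier G" using h by (auto simp: xs_def)
    note lim = c(3)[OF this]
    have "monomial xs (\<lambda>h. c (h \<otimes>\<^bsub>G\<^esub> g)) = (\<Prod>i=1..l. d i (h i \<otimes>\<^bsub>G\<^esub> g) ^ t i)" for g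
      unfolding mono_xs by (intro prod.cong refl) (simp only: cd)
    moreover have "monomial xs (\<lambda>h. f (\<tau> h x)) = (\<Prod>i=1..l. translate \<tau> (h i) (\<lambda>y. fs i y ^ t i) x)" for x
      unfolding mono_xs translate_def comp_def by (intro prod.cong refl) (simp only: cd)
    ultimately show "(\<lambda>n. 1 / of_nat (card (F n)) * (\<Sum>g\<in>F n. \<Prod>i=1..l. d i (h i \<otimes>\<^bsub>G\<^esub> g) ^ t i))
        \<longlonglongrightarrow> (\<integral>x. (\<Prod>i=1..l. translate \<tau> (h i) (\<lambda>y. fs i y ^ t i) x) \<partial>M)"
      using lim by simp
  qed
qed

end
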